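(* Let $n\ge1$ and let $g\in\mathrm{SU}(n)\ltimes\mathbb{C}^n$ be such that the linear part of $g$ is strongly reversible in $\mathrm{SU}(n)$. Then $g$ is not strongly reversible in $\mathrm{SU}(n)\ltimes\mathbb{C}^n$ if and only if $g$ is conjugate in $\mathrm{SU}(n)\ltimes\mathbb{C}^n$ to an element of the form $(A,v)$ such that $$A=\mathrm{diag}(e^{i\theta_1},e^{-i\theta_1},\dots,e^{i\theta_{2r}},e^{-i\theta_{2r}},1),\qquad v=[0,0,\dots,0,v_1],$$ where $v_1\in\mathbb{C}$, $v_1\neq0$, $r\ge0$ is an integer (so that $n=4r+1$), and $\theta_k\in(0,\pi)$ for $k=1,\dots,2r$.
   Context: $\mathrm{SU}(n)$ is the group of complex unitary $n\times n$ matrices of determinant $1$. Elements of $\mathrm{SU}(n)\ltimes\mathbb{C}^n$ are pairs $(A,v)$ with $A\in\mathrm{SU}(n)$ (the linear part), $v\in\mathbb{C}^n$, acting as the affine maps $z\mapsto Az+v$ of $\mathbb{C}^n$; the group operation is composition. An element $g$ of a group $G$ is strongly reversible in $G$ if there is $h\in G$ with $h^2=1$ and $hgh^{-1}=g^{-1}$. When $r=0$ the displayed matrix is $A=(1)$ and $n=1$. *)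

theory Defs
  imports
    "HOL-Algebra.Group"
    "Jordan_Normal_Form.Determinant"
    "Jordan_Normal_Form.Schur_Decomposition"
begin

definition special_unitary :: "nat \<Rightarrow> complex mat monoid" where
  "special_unitary n =
     \<lparr>carrier = {A \<in> carrier_mat n n. mat_adjoint A * A = 1\<^sub>m n \<and> det A = 1},
      monoid.mult = (\<lambda>A B. A * B), one = 1\<^sub>m n\<rparr>"

definition affine_action :: "complex mat \<times> complex vec \<Rightarrow> complex vec \<Rightarrow> complex vec" where
  "affine_action g z = fst g *\<^sub>v z + snd g"

(* The product of (A, v) and (B, w) is the pair of the composite map
   z |-> A (B z + w) + v; see affine_action_mult below. *)
definition special_unitary_affine :: "nat \<Rightarrow> (complex mat \<times> complex vec) monoid" where
  "special_unitary_affine n =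
     \<lparr>carrier = carrier (special_unitary n) \<times> carrier_vec n,
      monoid.mult = (\<lambda>(A, v) (B, w). (A * B, A *\<^sub>v w + v)), one = (1\<^sub>m n, 0\<^sub>v n)\<rparr>"

(* The conjugating element h may be the identity. *)
definition strongly_reversible :: "('a, 'b) monoid_scheme \<Rightarrow> 'a \<Rightarrow> bool" where
  "strongly_reversible G g \<longleftrightarrow>
     (\<exists>h\<in>carrier G. h \<otimes>\<^bsub>G\<^esub> h = \<one>\<^bsub>G\<^esub> \<and> h \<otimes>\<^bsub>G\<^esub> g \<otimes>\<^bsub>G\<^esub> inv\<^bsub>G\<^esub> h = inv\<^bsub>G\<^esub> g)"

definition conjugate_in :: "('a, 'b) monoid_scheme \<Rightarrow> 'a \<Rightarrow> 'a \<Rightarrow> bool" where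
  "conjugate_in G x y \<longleftrightarrow> (\<exists>h\<in>carrier G. h \<otimes>\<^bsub>G\<^esub> x \<otimes>\<^bsub>G\<^esub> inv\<^bsub>G\<^esub> h = y)"

(* diag(e^(i theta_1), e^(-i theta_1), ..., e^(i theta_(2r)), e^(-i theta_(2r)), 1):
   rows and columns are numbered from 0, the angles from 1, so that the positions
   2k - 2 and 2k - 1 belong to theta_k. *)
definition rotation_diag :: "nat \<Rightarrow> (nat \<Rightarrow> real) \<Rightarrow> complex mat" where
  "rotation_diag r \<theta> = mat_diag (4 * r + 1)
     (\<lambda>j. if j = 4 * r then 1
          else if even j then exp (\<i> * of_real (\<theta> (j div 2 + 1)))
          else exp (- \<i> * of_real (\<theta> (j div 2 + 1))))"

definition last_coord_vec :: "nat \<Rightarrow> complex \<Rightarrow> complex vec" where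
  "last_coord_vec r c = vec (4 * r + 1) (\<lambda>j. if j = 4 * r then c else 0)"

lemma mat_adjoint_altdef: "mat_adjoint A = map_mat cnj (transpose_mat A)"
  by (rule eq_matI) (auto simp: mat_adjoint_def mat_of_rows_def)

lemma mat_adjoint_carrier: "(A :: complex mat) \<in> carrier_mat n n \<Longrightarrow> mat_adjoint A \<in> carrier_mat n n"
  by (simp add: mat_adjoint_altdef)

lemma mat_adjoint_mult:
  assumes "A \<in> carrier_mat n n" "(B :: complex mat) \<in> carrier_mat n n"
  shows "mat_adjoint (A * B) = mat_adjoint B * mat_adjoint A"
proof -
  interpret cnj: comm_ring_hom cnj
    by unfold_locales auto
  have "mat_adjoint (A * B) = map_mat cnj (transpose_mat B * transpose_mat A)"
    by (simp only: mat_adjoint_altdef transpose_mult[OF assms])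
  also have "\<dots> = map_mat cnj (transpose_mat B) * map_mat cnj (transpose_mat A)"
    by (rule cnj.mat_hom_mult) (use assms in simp_all)
  finally show ?thesis
    by (simp only: mat_adjoint_altdef)
qed

lemma det_mat_adjoint:
  assumes "A \<in> carrier_mat n n"
  shows "det (mat_adjoint A) = cnj (det A)"
proof -
  interpret cnj: comm_ring_hom cnj
    by unfold_locales auto
  show ?thesis
    by (simp only: mat_adjoint_altdef cnj.hom_det det_transpose[OF assms])
qed

lemma group_special_unitary: "group (special_unitary n)"
proof (rule groupI)
  fix A B assume "A \<in> carrier (special_unitary n)" "B \<in> carrier (special_unitary n)"
  then have A: "A \<in> carrier_mat n n" "mat_adjoint A * A = 1\<^sub>m n" "det A = 1"
    and B: "B \<in> carrier_mat n n" "mat_adjoint B * B = 1\<^sub>m n" "det B = 1"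
    by (auto simp: special_unitary_def)
  note c = A(1) B(1) mat_adjoint_carrier[OF A(1)] mat_adjoint_carrier[OF B(1)]
  have "mat_adjoint (A * B) * (A * B) = mat_adjoint B * (mat_adjoint A * (A * B))"
    using c by (simp add: mat_adjoint_mult[of _ n] assoc_mult_mat[of _ n n _ n _ n])
  also have "mat_adjoint A * (A * B) = (mat_adjoint A * A) * B"
    using c by (simp add: assoc_mult_mat[of _ n n _ n _ n])
  finally have "mat_adjoint (A * B) * (A * B) = 1\<^sub>m n"
    using A B by simp
  then show "A \<otimes>\<^bsub>special_unitary n\<^esub> B \<in> carrier (special_unitary n)"
    using A B by (auto simp: special_unitary_def det_mult[of _ n])
next
  show "\<one>\<^bsub>special_unitary n\<^esub> \<in> carrier (special_unitary n)"
    by (auto simp: special_unitary_def mat_adjoint_altdef intro!: eq_matI)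
next
  fix A assume "A \<in> carrier (special_unitary n)"
  then have A: "A \<in> carrier_mat n n" "mat_adjoint A * A = 1\<^sub>m n" "det A = 1"
    by (auto simp: special_unitary_def)
  have "A * mat_adjoint A = 1\<^sub>m n"
    using A by (intro mat_mult_left_right_inverse[of "mat_adjoint A" n A] mat_adjoint_carrier)
  moreover have "mat_adjoint (mat_adjoint A) = A"
    by (rule eq_matI) (auto simp: mat_adjoint_altdef)
  ultimately have "mat_adjoint A \<in> carrier (special_unitary n)"
    using A mat_adjoint_carrier[OF A(1)] by (simp add: special_unitary_def det_mat_adjoint[of _ n])
  then show "\<exists>B\<in>carrier (special_unitary n). B \<otimes>\<^bsub>special_unitary n\<^esub> A = \<one>\<^bsub>special_unitary n\<^esub>"
    using A(2) by (auto simp: special_unitary_def)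
qed (auto simp: special_unitary_def assoc_mult_mat[of _ n n _ n _ n])

lemma affine_action_mult:
  assumes "g \<in> carrier (special_unitary_affine n)" "h \<in> carrier (special_unitary_affine n)"
    and "z \<in> carrier_vec n"
  shows "affine_action (g \<otimes>\<^bsub>special_unitary_affine n\<^esub> h) z = affine_action g (affine_action h z)"
proof -
  obtain A v B w where gh: "g = (A, v)" "h = (B, w)"
    by (metis surj_pair)
  with assms have c: "A \<in> carrier_mat n n" "B \<in> carrier_mat n n"
    "v \<in> carrier_vec n" "w \<in> carrier_vec n"
    by (auto simp: special_unitary_affine_def special_unitary_def)
  have "A * B *\<^sub>v z + (A *\<^sub>v w + v) = A *\<^sub>v (B *\<^sub>v z + w) + v"
    using c assms(3)
    by (simp add: mult_add_distrib_mat_vec[of _ n n] assoc_mult_mat_vec[of _ n n _ n]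
        assoc_add_vec[of _ n])
  then show ?thesis
    by (simp add: gh affine_action_def special_unitary_affine_def)
qed

lemma group_special_unitary_affine: "group (special_unitary_affine n)"
proof -
  interpret SU: group "special_unitary n"
    by (rule group_special_unitary)
  have simps: "A \<otimes>\<^bsub>special_unitary n\<^esub> B = A * B" "\<one>\<^bsub>special_unitary n\<^esub> = 1\<^sub>m n" for A B
    by (simp_all add: special_unitary_def)
  have cm: "A \<in> carrier_mat n n" if "A \<in> carrier (special_unitary n)" for A
    using that by (simp add: special_unitary_def)
  show ?thesis
  proof (rule groupI)
    fix g h assume "g \<in> carrier (special_unitary_affine n)" "h \<in> carrier (special_unitary_affine n)"
    then obtain A v B w where eqs: "g = (A, v)" "h = (B, w)"
      and AB: "A \<in> carrier (special_unitary n)" "B \<in> carrier (special_unitary n)"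
      and vw: "v \<in> carrier_vec n" "w \<in> carrier_vec n"
      by (auto simp: special_unitary_affine_def)
    have "A *\<^sub>v w + v \<in> carrier_vec n"
      using cm[OF AB(1)] vw by simp
    then show "g \<otimes>\<^bsub>special_unitary_affine n\<^esub> h \<in> carrier (special_unitary_affine n)"
      using SU.m_closed[OF AB] by (simp add: eqs special_unitary_affine_def simps)
  next
    fix g h k assume ghk: "g \<in> carrier (special_unitary_affine n)"
      "h \<in> carrier (special_unitary_affine n)" "k \<in> carrier (special_unitary_affine n)"
    obtain A u B v C w where eqs: "g = (A, u)" "h = (B, v)" "k = (C, w)"
      by (metis surj_pair)
    with ghk have c: "A \<in> carrier_mat n n" "B \<in> carrier_mat n n" "C \<in> carrier_mat n n"
      "u \<in> carrier_vec n" "v \<in> carrier_vec n" "w \<in> carrier_vec n"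
      by (auto simp: special_unitary_affine_def intro: cm)
    then show "g \<otimes>\<^bsub>special_unitary_affine n\<^esub> h \<otimes>\<^bsub>special_unitary_affine n\<^esub> k =
        g \<otimes>\<^bsub>special_unitary_affine n\<^esub> (h \<otimes>\<^bsub>special_unitary_affine n\<^esub> k)"
      by (simp add: eqs special_unitary_affine_def assoc_mult_mat[of _ n n _ n _ n]
          mult_add_distrib_mat_vec[of _ n n] assoc_mult_mat_vec[of _ n n _ n]
          assoc_add_vec[of _ n])
  next
    fix g assume g: "g \<in> carrier (special_unitary_affine n)"
    obtain A v where eq: "g = (A, v)"
      by (metis surj_pair)
    with g have A: "A \<in> carrier (special_unitary n)" and v: "v \<in> carrier_vec n"
      by (auto simp: special_unitary_affine_def)
    from SU.l_inv_ex[OF A] obtain B where B: "B \<in> carrier (special_unitary n)" "B * A = 1\<^sub>m n"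
      by (auto simp: simps)
    show "\<one>\<^bsub>special_unitary_affine n\<^esub> \<otimes>\<^bsub>special_unitary_affine n\<^esub> g = g"
      using cm[OF A] v by (simp add: eq special_unitary_affine_def)
    have "(B, - (B *\<^sub>v v)) \<in> carrier (special_unitary_affine n)"
      using B cm[of B] v by (auto simp: special_unitary_affine_def)
    moreover have "(B, - (B *\<^sub>v v)) \<otimes>\<^bsub>special_unitary_affine n\<^esub> g = \<one>\<^bsub>special_unitary_affine n\<^esub>"
      using B cm[OF B(1)] v by (simp add: eq special_unitary_affine_def)
    ultimately show "\<exists>h\<in>carrier (special_unitary_affine n).
        h \<otimes>\<^bsub>special_unitary_affine n\<^esub> g = \<one>\<^bsub>special_unitary_affine n\<^esub>"
      by blast
  qed (use SU.one_closed in \<open>auto simp: special_unitary_affine_def simps\<close>)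
qed

end

theory Submission
  imports Defs
begin

text \<open>
  A translation and a special unitary change of basis bring \<open>g = (A, v)\<close> to the form where \<open>A\<close> is
  diagonal and \<open>A v = v\<close>. Then \<open>g\<close> is strongly reversible iff \<open>v = 0\<close> or some \<open>B\<close> in \<open>SU(n)\<close> with
  \<open>B\<^sup>2 = 1\<close> inverts \<open>A\<close> and satisfies \<open>B v = - v\<close>. Such a \<open>B\<close> must swap the eigenspaces of \<open>\<lambda>\<close> and
  \<open>cnj \<lambda>\<close>, so each of the \<open>k\<close> conjugate pairs contributes \<open>- 1\<close> to \<open>det B\<close>. On the eigenspaces of
  \<open>1\<close> and \<open>- 1\<close> the signs are free except for the one on \<open>v\<close>, which is \<open>- 1\<close>. Hence \<open>det B = 1\<close> is out
  of reach exactly when \<open>k\<close> is even and the real eigenspaces reduce to the line spanned by \<open>v\<close>.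
\<close>

subsection \<open>Unitary matrices and their diagonalization\<close>

text \<open>The unitary group U(n) as a bare set. Diagonalization first yields a unitary basis
  change; its determinant is corrected only later, in
  \<open>special_unitary_rescale\<close>.\<close>

definition unitary_mats :: "nat \<Rightarrow> complex mat set" where
  "unitary_mats n = {U \<in> carrier_mat n n. mat_adjoint U * U = 1\<^sub>m n}"

lemma index_mult_mat_sum:
  assumes "A \<in> carrier_mat m k" "B \<in> carrier_mat k n" "i < m" "j < n"
  shows "(A * B) $$ (i, j) = (\<Sum>l<k. A $$ (i, l) * B $$ (l, j))"
  using assms by (auto simp: scalar_prod_def atLeast0LessThan)

lemma index_mult_mat_vec_sum:
  assumes "A \<in> carrier_mat m k" "v \<in> carrier_vec k" "i < m"
  shows "(A *\<^sub>v v) $ i = (\<Sum>l<k. A $$ (i, l) * v $ l)"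
  using assms by (auto simp: scalar_prod_def atLeast0LessThan)

lemma index_mat_adjoint [simp]:
  "i < dim_col A \<Longrightarrow> j < dim_row A \<Longrightarrow> mat_adjoint A $$ (i, j) = cnj (A $$ (j, i))"
  by (simp add: mat_adjoint_altdef)

lemma dim_mat_adjoint [simp]:
  "dim_row (mat_adjoint (A :: complex mat)) = dim_col A"
  "dim_col (mat_adjoint (A :: complex mat)) = dim_row A"
  by (simp_all add: mat_adjoint_altdef)

lemma mat_adjoint_adjoint [simp]: "mat_adjoint (mat_adjoint (A :: complex mat)) = A"
  by (rule eq_matI) auto

lemma mat_adjoint_mat_diag [simp]: "mat_adjoint (mat_diag n f) = mat_diag n (\<lambda>i. cnj (f i))"
  by (rule eq_matI) (auto simp: mat_diag_def)

lemma unitaryD: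
  assumes "U \<in> unitary_mats n"
  shows "U \<in> carrier_mat n n" "mat_adjoint U \<in> carrier_mat n n"
    "mat_adjoint U * U = 1\<^sub>m n" "U * mat_adjoint U = 1\<^sub>m n"
proof -
  show "U \<in> carrier_mat n n" "mat_adjoint U * U = 1\<^sub>m n"
    using assms by (auto simp: unitary_mats_def)
  then show "mat_adjoint U \<in> carrier_mat n n"
    by (intro mat_adjoint_carrier)
  then show "U * mat_adjoint U = 1\<^sub>m n"
    using \<open>U \<in> carrier_mat n n\<close> \<open>mat_adjoint U * U = 1\<^sub>m n\<close>
    by (intro mat_mult_left_right_inverse[of "mat_adjoint U" n U])
qed

lemma unitary_cancel:
  assumes "U \<in> unitary_mats n" "X \<in> carrier_mat n m"
  shows "mat_adjoint U * (U * X) = X" "U * (mat_adjoint U * X) = X"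
  using unitaryD[OF assms(1)] assms(2)
  by (simp_all add: assoc_mult_mat[of _ n n _ n _ m, symmetric])

lemma unitary_cancel_vec:
  assumes "U \<in> unitary_mats n" "x \<in> carrier_vec n"
  shows "mat_adjoint U *\<^sub>v (U *\<^sub>v x) = x" "U *\<^sub>v (mat_adjoint U *\<^sub>v x) = x"
  using unitaryD[OF assms(1)] assms(2)
  by (simp_all add: assoc_mult_mat_vec[of _ n n _ n, symmetric])

lemma unitary_adjoint:
  assumes "U \<in> unitary_mats n"
  shows "mat_adjoint U \<in> unitary_mats n"
  using unitaryD(2,4)[OF assms] by (simp add: unitary_mats_def)

lemma unitary_mult:
  assumes "U \<in> unitary_mats n" "V \<in> unitary_mats n"
  shows "U * V \<in> unitary_mats n"
proof -
  note U = unitaryD[OF assms(1)] and V = unitaryD[OF assms(2)]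
  have "mat_adjoint (U * V) * (U * V) = mat_adjoint V * (mat_adjoint U * (U * V))"
    using U V by (simp add: mat_adjoint_mult[of _ n] assoc_mult_mat[of _ n n _ n _ n])
  then show ?thesis
    using U V by (simp add: unitary_mats_def unitary_cancel[OF assms(1)])
qed

lemma unitary_mat_diag_iff:
  "mat_diag n f \<in> unitary_mats n \<longleftrightarrow> (\<forall>i<n. norm (f i) = 1)"
proof -
  have "mat_diag n f \<in> unitary_mats n \<longleftrightarrow> mat_diag n (\<lambda>i. cnj (f i) * f i) = 1\<^sub>m n"
    by (simp add: unitary_mats_def)
  also have "\<dots> \<longleftrightarrow> (\<forall>i<n. cnj (f i) * f i = 1)"
    by (auto simp: mat_diag_def mat_eq_iff)
  also have "\<dots> \<longleftrightarrow> (\<forall>i<n. norm (f i) = 1)"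
    by (auto simp: complex_norm_square[symmetric] mult.commute[of "cnj _"] abs_square_eq_1
        simp flip: of_real_power)
  finally show ?thesis .
qed

lemma norm_det_unitary:
  assumes "U \<in> unitary_mats n"
  shows "cnj (det U) * det U = 1" "norm (det U) = 1"
proof -
  note U = unitaryD[OF assms]
  have "cnj (det U) * det U = det (mat_adjoint U * U)"
    using det_mult[OF U(2,1)] det_mat_adjoint[OF U(1)] by simp
  then show 1: "cnj (det U) * det U = 1"
    using U by simp
  then have "norm (cnj (det U) * det U) = 1"
    by simp
  then show "norm (det U) = 1"
    by (simp add: norm_mult abs_square_eq_1 flip: power2_eq_square)
qed

lemma det_mat_diag: "det (mat_diag n f) = (\<Prod>i<n. f i)"
proof -
  have "det (mat_diag n f) = prod_list (diag_mat (mat_diag n f))"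
    by (rule det_upper_triangular[of _ n]) (auto simp: mat_diag_def)
  also have "diag_mat (mat_diag n f) = map f [0..<n]"
    by (auto simp: diag_mat_def mat_diag_def)
  finally show ?thesis
    by (simp add: prod.distinct_set_conv_list[symmetric] atLeast0LessThan)
qed

section \<open>The spectral theorem for unitary matrices, with a prescribed last eigenvector\<close>

lemma char_poly_mat_diag: "char_poly (mat_diag n f) = (\<Prod>a\<leftarrow>map f [0..<n]. [:- a, 1:])"
proof -
  have "char_poly (mat_diag n f) = (\<Prod>a\<leftarrow>diag_mat (mat_diag n f). [:- a, 1:])"
    by (rule char_poly_upper_triangular[of _ n]) (auto simp: mat_diag_def)
  also have "diag_mat (mat_diag n f) = map f [0..<n]"
    by (auto simp: diag_mat_def mat_diag_def)
  finally show ?thesis .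
qed

lemma char_poly_unitary_conj:
  assumes "U \<in> unitary_mats n" "A \<in> carrier_mat n n"
  shows "char_poly (mat_adjoint U * A * U) = char_poly A"
proof (rule char_poly_similar)
  note U = unitaryD[OF assms(1)]
  show "similar_mat (mat_adjoint U * A * U) A"
    unfolding similar_mat_def
    by (intro exI, rule similar_mat_witI[of "mat_adjoint U" U n]) (use U assms(2) in auto)
qed

text \<open>Completing \<open>u\<close> to a basis and applying Gram-Schmidt leaves \<open>u\<close>
  as the first vector of an orthogonal basis. It is moved to the last column because the normal form
  carries the eigenvalue 1 of the fixed vector in the last place.\<close>

lemma unitary_last_col_exists:
  assumes u: "u \<in> carrier_vec n" "u \<noteq> 0\<^sub>v n"
  obtains U c where "U \<in> unitary_mats n" "c \<noteq> 0" "col U (n - 1) = c \<cdot>\<^sub>v u"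
proof -
  interpret cof_vec_space n "TYPE(complex)" .
  define ws where "ws = gram_schmidt n (basis_completion u)"
  note bc = basis_completion[OF u]
  note gs = gram_schmidt_result[OF bc(2,4,5) ws_def]
  have n: "n > 0"
    using u by (cases n) auto
  have len: "length ws = n"
    using gs(4) bc(6) by simp
  have "basis_completion u \<noteq> []"
    using bc(6) n by auto
  then obtain vs where "basis_completion u = u # vs"
    using bc(7) by (cases "basis_completion u") auto
  then have hd: "ws ! 0 = u"
  proof -
    have "hd ws = u"
      unfolding ws_def \<open>basis_completion u = u # vs\<close> by (rule gram_schmidt_hd[OF u(1)])
    moreover have "ws \<noteq> []"
      using len n by (metis length_0_conv less_numeral_extra(3))
    ultimately show ?thesis
      by (metis hd_conv_nth)
  qed
  have ws: "ws ! i \<in> carrier_vec n" if "i < n" for i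
    using gs(3) nth_mem[of i ws] that unfolding len by blast
  define N where "N i = (\<Sum>l<n. (norm (ws ! i $ l))\<^sup>2)" for i
  have ip: "ws ! i \<bullet>c ws ! j = (\<Sum>l<n. cnj (ws ! j $ l) * ws ! i $ l)" if "i < n" "j < n" for i j
    using ws[OF that(1)] ws[OF that(2)] by (auto simp: scalar_prod_def atLeast0LessThan mult.commute)
  have ipN: "(\<Sum>l<n. cnj (ws ! i $ l) * ws ! i $ l) = of_real (N i)" for i
    unfolding N_def of_real_sum by (intro sum.cong refl) (simp add: complex_norm_square mult.commute flip: of_real_power)
  have N: "N i > 0" if "i < n" for i
  proof -
    have "N i \<noteq> 0"
      using corthogonalD[OF gs(2), of i i] that len ip[of i i] ipN[of i] by auto
    moreover have "N i \<ge> 0"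
      by (auto simp: N_def intro: sum_nonneg)
    ultimately show ?thesis by simp
  qed
  \<comment> \<open>Reversing the list puts \<open>ws ! 0 = u\<close> into column
    \<open>n - 1\<close>. The factors \<open>s\<close> normalize, since Gram-Schmidt here gives
    orthogonal but not unit vectors.\<close>
  define f where "f j = ws ! (n - 1 - j)" for j
  define s where "s j = complex_of_real (1 / sqrt (N (n - 1 - j)))" for j
  define U where "U = mat n n (\<lambda>(i, j). s j * f j $ i)"
  have Uc: "U \<in> carrier_mat n n"
    by (simp add: U_def)
  have "mat_adjoint U * U = 1\<^sub>m n"
  proof (rule eq_matI, goal_cases)
    case (1 i j)
    then have ij: "i < n" "j < n" by auto
    have "(mat_adjoint U * U) $$ (i, j) = (\<Sum>l<n. mat_adjoint U $$ (i, l) * U $$ (l, j))"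
      using ij Uc by (intro index_mult_mat_sum[of _ n n]) auto
    also have "\<dots> = s i * s j * (\<Sum>l<n. cnj (f i $ l) * f j $ l)"
      using ij by (auto simp: U_def s_def sum_distrib_left intro!: sum.cong)
    also have "\<dots> = (if i = j then 1 else 0)"
    proof (cases "i = j")
      case True
      have "sqrt (N (n - 1 - j)) * sqrt (N (n - 1 - j)) = N (n - 1 - j)"
        using N[of "n - 1 - j"] ij by simp
      then show ?thesis
        using True N[of "n - 1 - j"] ij ipN
        by (simp add: f_def s_def field_simps flip: of_real_mult)
    next
      case False
      have "ws ! (n - 1 - j) \<bullet>c ws ! (n - 1 - i) = 0"
        using corthogonalD[OF gs(2), of "n - 1 - j" "n - 1 - i"] len ij False by auto
      then show ?thesis
        using False ij ip[of "n - 1 - j" "n - 1 - i"] by (simp add: f_def)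
    qed
    finally show ?case using ij by simp
  qed (use Uc in auto)
  moreover have "col U (n - 1) = s (n - 1) \<cdot>\<^sub>v u"
    using n u hd by (intro eq_vecI) (auto simp: U_def f_def)
  moreover have "s (n - 1) \<noteq> 0"
    using N[of 0] n by (simp add: s_def)
  ultimately show ?thesis
    using that Uc by (auto simp: unitary_mats_def)
qed


text \<open>Applying the adjoint to the eigenvector equation gives \<open>x = e\<close> times the
  adjoint applied to \<open>x\<close>. An eigenvector is therefore shared with the adjoint, which
  makes the last row vanish along with the last column in the diagonalization step.\<close>

lemma unitary_eigenvector_adjoint:
  assumes "U \<in> unitary_mats n" "x \<in> carrier_vec n" "x \<noteq> 0\<^sub>v n" "U *\<^sub>v x = e \<cdot>\<^sub>v x"
  shows "e \<noteq> 0" "mat_adjoint U *\<^sub>v x = inverse e \<cdot>\<^sub>v x"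
proof -
  note U = unitaryD[OF assms(1)]
  define y where "y = mat_adjoint U *\<^sub>v x"
  have y: "y \<in> carrier_vec n"
    using U assms(2) by (simp add: y_def)
  have xy: "x = e \<cdot>\<^sub>v y"
    using unitary_cancel_vec(1)[OF assms(1,2)] U assms(2,4) by (simp add: y_def mult_mat_vec[of _ n n])
  show e: "e \<noteq> 0"
  proof
    assume "e = 0"
    then have "x = 0\<^sub>v n"
      using xy y by auto
    then show False
      using assms(3) by simp
  qed
  then have "inverse e \<cdot>\<^sub>v x = y"
    unfolding xy using y by (simp add: smult_smult_assoc)
  then show "mat_adjoint U *\<^sub>v x = inverse e \<cdot>\<^sub>v x"
    by (simp add: y_def)
qed

lemma mult_block_diag:
  fixes A B C D :: "'a :: semiring_1 mat"
  assumes "A \<in> carrier_mat m m" "B \<in> carrier_mat k k" "C \<in> carrier_mat m m" "D \<in> carrier_mat k k"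
  shows "four_block_mat A (0\<^sub>m m k) (0\<^sub>m k m) B * four_block_mat C (0\<^sub>m m k) (0\<^sub>m k m) D =
    four_block_mat (A * C) (0\<^sub>m m k) (0\<^sub>m k m) (B * D)"
proof -
  have "A * C + 0\<^sub>m m k * 0\<^sub>m k m = A * C" "A * 0\<^sub>m m k + 0\<^sub>m m k * D = 0\<^sub>m m k"
    "0\<^sub>m k m * C + B * 0\<^sub>m k m = 0\<^sub>m k m" "0\<^sub>m k m * 0\<^sub>m m k + B * D = B * D"
    using assms by simp_all
  then show ?thesis
    using mult_four_block_mat[OF assms(1) zero_carrier_mat zero_carrier_mat assms(2)
        assms(3) zero_carrier_mat zero_carrier_mat assms(4)] by simp
qed

text \<open>In a unitary basis ending in a multiple of \<open>u\<close>, the matrix splits into a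
  unitary block of size \<open>n - 1\<close> and the entry \<open>e\<close>; the block is
  diagonalized by \<open>IH\<close>. Keeping the induction hypothesis as an assumption allows the
  step to be reused afterwards for its second conclusion, the control of the last column.\<close>

lemma unitary_diagonalize_step:
  fixes es :: "complex list"
  assumes IH: "\<And>m B. B \<in> unitary_mats m \<Longrightarrow> char_poly B = (\<Prod>a\<leftarrow>es. [:- a, 1:]) \<Longrightarrow>
      \<exists>V\<in>unitary_mats m. B * V = V * mat_diag m (\<lambda>i. es ! i)"
    and A: "A \<in> unitary_mats n"
    and cp: "char_poly A = (\<Prod>a\<leftarrow>es @ [e]. [:- a, 1:])"
    and u: "u \<in> carrier_vec n" "u \<noteq> 0\<^sub>v n" "A *\<^sub>v u = e \<cdot>\<^sub>v u"
  shows "\<exists>U\<in>unitary_mats n. A * U = U * mat_diag n (\<lambda>i. (es @ [e]) ! i) \<and>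
    (\<exists>c. c \<noteq> 0 \<and> col U (n - 1) = c \<cdot>\<^sub>v u)"
proof -
  note Ac = unitaryD[OF A]
  obtain W c where W: "W \<in> unitary_mats n" and c: "c \<noteq> 0" "col W (n - 1) = c \<cdot>\<^sub>v u"
    using unitary_last_col_exists[OF u(1,2)] .
  note Wc = unitaryD[OF W]
  define m where "m = n - 1"
  have n: "n = m + 1"
    using u by (cases n) (auto simp: m_def)
  have len: "length es = m"
  proof -
    have "degree (char_poly A) = length (es @ [e])"
      unfolding cp by (rule degree_linear_factors)
    then show ?thesis
      using degree_monic_char_poly[OF Ac(1)] n by simp
  qed
  define A' where "A' = mat_adjoint W * A * W"
  have A': "A' \<in> unitary_mats n"
    unfolding A'_def by (intro unitary_mult unitary_adjoint W A)
  note A'c = unitaryD[OF A']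
  define l :: "complex vec" where "l = unit_vec n m"
  have l: "l \<in> carrier_vec n" "l \<noteq> 0\<^sub>v n"
    using n by (auto simp: l_def)
  have col: "X *\<^sub>v l = col X m" if "X \<in> carrier_mat n n" for X
    using that n by (intro eq_vecI) (auto simp: l_def)
  have Wl: "W *\<^sub>v l = c \<cdot>\<^sub>v u"
    using col[OF Wc(1)] c(2) by (simp add: m_def)
  have "A' *\<^sub>v l = mat_adjoint W *\<^sub>v (A *\<^sub>v (W *\<^sub>v l))"
    unfolding A'_def using Wc Ac l by (simp add: assoc_mult_mat_vec[of _ n n _ n])
  also have "A *\<^sub>v (W *\<^sub>v l) = e \<cdot>\<^sub>v (W *\<^sub>v l)"
    unfolding Wl using Ac u by (simp add: mult_mat_vec[of _ n n] smult_smult_assoc mult.commute)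
  also have "mat_adjoint W *\<^sub>v (e \<cdot>\<^sub>v (W *\<^sub>v l)) = e \<cdot>\<^sub>v l"
    using Wc l by (simp add: mult_mat_vec[of _ n n] unitary_cancel_vec[OF W])
  finally have A'l: "A' *\<^sub>v l = e \<cdot>\<^sub>v l" .
  have colA': "A' $$ (i, m) = (if i = m then e else 0)" if "i < n" for i
  proof -
    have "A' $$ (i, m) = (A' *\<^sub>v l) $ i"
      using col[OF A'c(1)] A'c(1) that n by simp
    also have "\<dots> = (if i = m then e else 0)"
      unfolding A'l using that n by (auto simp: l_def)
    finally show ?thesis .
  qed
  \<comment> \<open>The vector \<open>l\<close> is also an eigenvector of the adjoint, so the last
    row is zero off the diagonal: unitarity upgrades block triangular to block diagonal.\<close>
  have rowA': "A' $$ (m, j) = 0" if "j < m" for j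
  proof -
    have "cnj (A' $$ (m, j)) = col (mat_adjoint A') m $ j"
      using A'c n that by auto
    also have "\<dots> = (mat_adjoint A' *\<^sub>v l) $ j"
      using col[OF A'c(2)] by simp
    also have "\<dots> = 0"
      using unitary_eigenvector_adjoint(2)[OF A' l A'l] that n by (auto simp: l_def)
    finally show ?thesis by simp
  qed
  define B where "B = mat m m (\<lambda>(i, j). A' $$ (i, j))"
  define E where "E = mat 1 1 (\<lambda>_. e)"
  have Bc: "B \<in> carrier_mat m m" and Ec: "E \<in> carrier_mat 1 1"
    by (simp_all add: B_def E_def)
  have blk: "A' = four_block_mat B (0\<^sub>m m 1) (0\<^sub>m 1 m) E"
  proof (rule eq_matI, goal_cases)
    case (1 i j)
    then have ij: "i < n" "j < n"
      using n by (auto simp: B_def E_def)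
    consider "i < m" "j < m" | "i < m" "j = m" | "i = m" "j < m" | "i = m" "j = m"
      using ij n by linarith
    then show ?case
      using ij n colA'[of i] rowA'[of j] by cases (auto simp: B_def E_def)
  qed (use A'c n in \<open>auto simp: B_def E_def\<close>)
  have BU: "B \<in> unitary_mats m"
  proof -
    have "mat_adjoint B * B = 1\<^sub>m m"
    proof (rule eq_matI, goal_cases)
      case (1 i j)
      then have ij: "i < m" "j < m" by auto
      have "(mat_adjoint B * B) $$ (i, j) = (\<Sum>k<m. mat_adjoint B $$ (i, k) * B $$ (k, j))"
        using ij Bc by (intro index_mult_mat_sum[of _ m m]) auto
      also have "\<dots> = (\<Sum>k<m. mat_adjoint A' $$ (i, k) * A' $$ (k, j))"
        using ij A'c n by (intro sum.cong) (auto simp: B_def)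
      \<comment> \<open>The added summand \<open>k = m\<close> contains the factor
        \<open>A' $$ (m, j)\<close>, which is 0.\<close>
      also have "\<dots> = (\<Sum>k<n. mat_adjoint A' $$ (i, k) * A' $$ (k, j))"
        using rowA'[OF ij(2)] n by simp
      also have "\<dots> = (mat_adjoint A' * A') $$ (i, j)"
        using ij A'c n by (intro index_mult_mat_sum[of _ n n _ n, symmetric]) auto
      finally show ?case
        using ij n A'c by simp
    qed (use Bc in auto)
    then show ?thesis
      using Bc by (simp add: unitary_mats_def)
  qed
  have cpE: "char_poly E = [:- e, 1:]"
    by (simp add: E_def char_poly_defs det_def sign_def)
  have cpB: "char_poly B = (\<Prod>a\<leftarrow>es. [:- a, 1:])"
  proof -
    have "char_poly A' = char_poly B * char_poly E"
      using char_poly_factorized[OF Bc] char_poly_factorized[OF Ec]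
      by (intro char_poly_0_block'[OF blk _ _ Bc _ Ec]) auto
    moreover have "char_poly A' = char_poly A"
      unfolding A'_def by (rule char_poly_unitary_conj[OF W Ac(1)])
    ultimately have "char_poly B * [:- e, 1:] = (\<Prod>a\<leftarrow>es. [:- a, 1:]) * [:- e, 1:]"
      using cp cpE by simp
    then show ?thesis
      by (metis mult_cancel_right pCons_eq_0_iff zero_neq_one)
  qed
  obtain V where V: "V \<in> unitary_mats m" "B * V = V * mat_diag m (\<lambda>i. es ! i)"
    using IH[OF BU cpB] by blast
  note Vc = unitaryD[OF V(1)]
  \<comment> \<open>Extending \<open>V\<close> by a final 1 fixes \<open>l\<close>, so
    \<open>W * V'\<close> still has the last column of \<open>W\<close>.\<close>
  define V' where "V' = four_block_mat V (0\<^sub>m m 1) (0\<^sub>m 1 m) (1\<^sub>m 1)"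
  have V'c: "V' \<in> carrier_mat n n"
    unfolding V'_def n by (rule four_block_carrier_mat) (use Vc in auto)
  have adjV': "mat_adjoint V' = four_block_mat (mat_adjoint V) (0\<^sub>m m 1) (0\<^sub>m 1 m) (1\<^sub>m 1)"
    using Vc by (intro eq_matI) (auto simp: V'_def)
  have "mat_adjoint V' * V' = four_block_mat (1\<^sub>m m) (0\<^sub>m m 1) (0\<^sub>m 1 m) (1\<^sub>m 1)"
    unfolding adjV' unfolding V'_def mult_block_diag[OF Vc(2) one_carrier_mat Vc(1) one_carrier_mat] Vc(3)
    by simp
  also have "\<dots> = 1\<^sub>m n"
    using n by (intro eq_matI) auto
  finally have V'U: "V' \<in> unitary_mats n"
    using V'c by (simp add: unitary_mats_def)
  have D: "mat_diag n (\<lambda>i. (es @ [e]) ! i) =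
      four_block_mat (mat_diag m (\<lambda>i. es ! i)) (0\<^sub>m m 1) (0\<^sub>m 1 m) E"
    using n len by (intro eq_matI) (auto simp: mat_diag_def E_def nth_append)
  have E1: "E * 1\<^sub>m 1 = E" "1\<^sub>m 1 * E = E"
    using Ec by auto
  have "A' * V' = four_block_mat (B * V) (0\<^sub>m m 1) (0\<^sub>m 1 m) E"
    unfolding blk V'_def mult_block_diag[OF Bc Ec Vc(1) one_carrier_mat] E1 ..
  also have "\<dots> = V' * mat_diag n (\<lambda>i. (es @ [e]) ! i)"
    unfolding D V'_def V(2) mult_block_diag[OF Vc(1) one_carrier_mat mat_diag_dim Ec] E1 ..
  finally have A'V': "A' * V' = V' * mat_diag n (\<lambda>i. (es @ [e]) ! i)" .
  have U: "W * V' \<in> unitary_mats n"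
    by (rule unitary_mult[OF W V'U])
  have "W * (A' * V') = A * (W * V')"
    unfolding A'_def using Wc Ac V'c
    by (simp add: assoc_mult_mat[of _ n n _ n _ n] unitary_cancel[OF W, of _ n]
        mult_carrier_mat[of _ n n _ n])
  then have 1: "A * (W * V') = W * V' * mat_diag n (\<lambda>i. (es @ [e]) ! i)"
    using A'V' Wc V'c by (simp add: assoc_mult_mat[of _ n n _ n _ n])
  have "col V' m = l"
    using n Vc by (intro eq_vecI) (auto simp: V'_def l_def)
  then have "W * V' *\<^sub>v l = W *\<^sub>v l"
    using col[OF V'c] Wc V'c l by (simp add: assoc_mult_mat_vec[of _ n n _ n])
  then have 2: "col (W * V') (n - 1) = c \<cdot>\<^sub>v u"
    using col[of "W * V'"] Wc V'c Wl by (simp add: m_def)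
  show ?thesis
    using U 1 2 c(1) by blast
qed

text \<open>Induction from the right end of \<open>es\<close>, where the step splits off an
  eigenvalue. The list may enumerate the spectrum in any order, so the order along the diagonal is
  at choice.\<close>

lemma unitary_diagonalize:
  assumes "A \<in> unitary_mats n" "char_poly A = (\<Prod>a\<leftarrow>es. [:- a, 1:])"
  shows "\<exists>U\<in>unitary_mats n. A * U = U * mat_diag n (\<lambda>i. es ! i)"
  using assms
proof (induction es arbitrary: n A rule: rev_induct)
  case Nil
  note A = unitaryD[OF Nil(1)]
  have "n = 0"
    using degree_monic_char_poly[OF A(1)] Nil(2) by simp
  then show ?case
    using A(1) Nil(1) by (intro bexI[of _ A] eq_matI) (auto simp: mat_diag_def)
next
  case (snoc e es)
  note A = unitaryD[OF snoc.prems(1)]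
  have "poly (char_poly A) e = 0"
    unfolding snoc.prems(2) by simp
  then have "eigenvalue A e"
    using eigenvalue_root_char_poly[OF A(1)] by blast
  then obtain u where "u \<in> carrier_vec n" "u \<noteq> 0\<^sub>v n" "A *\<^sub>v u = e \<cdot>\<^sub>v u"
    using A(1) by (auto simp: eigenvalue_def eigenvector_def)
  from unitary_diagonalize_step[OF snoc.IH snoc.prems this] show ?case
    by blast
qed

text \<open>With the induction hypothesis supplied by the finished theorem, the step becomes a
  diagonalization whose last column is a multiple of a given eigenvector.\<close>

lemmas unitary_diagonalize_last = unitary_diagonalize_step[OF unitary_diagonalize]

subsection \<open>Conjugacy and strong reversibility in the affine group\<close>

lemma mult_mat_zero_vec:
  fixes A :: "'a :: semiring_0 mat"
  assumes "A \<in> carrier_mat m n"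
  shows "A *\<^sub>v 0\<^sub>v n = 0\<^sub>v m"
  using assms by (intro eq_vecI) auto

lemma in_carrier_special_unitary_iff:
  "A \<in> carrier (special_unitary n) \<longleftrightarrow> A \<in> unitary_mats n \<and> det A = 1"
  by (auto simp: special_unitary_def unitary_mats_def)

lemma special_unitary_ops [simp]:
  "A \<otimes>\<^bsub>special_unitary n\<^esub> B = A * B" "\<one>\<^bsub>special_unitary n\<^esub> = 1\<^sub>m n"
  by (simp_all add: special_unitary_def)

lemma in_carrier_affine_iff:
  "(A, v) \<in> carrier (special_unitary_affine n) \<longleftrightarrow>
    A \<in> unitary_mats n \<and> det A = 1 \<and> v \<in> carrier_vec n"
  by (auto simp: special_unitary_affine_def in_carrier_special_unitary_iff)

lemma affine_ops [simp]:
  "(A, v) \<otimes>\<^bsub>special_unitary_affine n\<^esub> (B, w) = (A * B, A *\<^sub>v w + v)"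
  "\<one>\<^bsub>special_unitary_affine n\<^esub> = (1\<^sub>m n, 0\<^sub>v n)"
  by (simp_all add: special_unitary_affine_def)

section \<open>Strong reversibility and conjugacy in an arbitrary group\<close>

context group
begin

text \<open>An involution is its own inverse, so the reversing equation says that \<open>h\<close>
  times \<open>g\<close> squares to 1. This form is free of inverses and can be computed directly on
  pairs of a matrix and a vector.\<close>

lemma strongly_reversible_iff:
  assumes "g \<in> carrier G"
  shows "strongly_reversible G g \<longleftrightarrow>
    (\<exists>h\<in>carrier G. h \<otimes> h = \<one> \<and> (h \<otimes> g) \<otimes> (h \<otimes> g) = \<one>)"
proof -
  have "h \<otimes> g \<otimes> inv h = inv g \<longleftrightarrow> (h \<otimes> g) \<otimes> (h \<otimes> g) = \<one>"
    if h: "h \<in> carrier G" "h \<otimes> h = \<one>" for h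
  proof -
    have "inv h = h"
      using h by (simp add: inv_equality)
    moreover have "h \<otimes> g \<otimes> h = inv g \<longleftrightarrow> h \<otimes> g \<otimes> h \<otimes> g = \<one>"
      using h assms inv_equality[of "h \<otimes> g \<otimes> h" g] by auto
    ultimately show ?thesis
      using h assms by (simp add: m_assoc)
  qed
  then show ?thesis
    unfolding strongly_reversible_def by blast
qed

lemma conjugate_in_iff:
  assumes "x \<in> carrier G" "y \<in> carrier G"
  shows "conjugate_in G x y \<longleftrightarrow> (\<exists>h\<in>carrier G. h \<otimes> x = y \<otimes> h)"
  unfolding conjugate_in_def using assms by (metis inv_solve_right m_closed)

lemma conjugate_in_closed:
  "conjugate_in G x y \<Longrightarrow> x \<in> carrier G \<Longrightarrow> y \<in> carrier G"
  by (auto simp: conjugate_in_def)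

lemma conjugate_in_sym:
  assumes "conjugate_in G x y" "x \<in> carrier G"
  shows "conjugate_in G y x"
proof -
  note y = conjugate_in_closed[OF assms]
  from assms obtain h where h: "h \<in> carrier G" "h \<otimes> x = y \<otimes> h"
    using conjugate_in_iff[OF assms(2) y] by blast
  have "inv h \<otimes> y = x \<otimes> inv h"
    using h assms(2) y by (metis inv_closed inv_solve_left inv_solve_right m_assoc m_closed)
  then show ?thesis
    using conjugate_in_iff[OF y assms(2)] h by blast
qed

lemma conjugate_in_trans:
  assumes "conjugate_in G x y" "conjugate_in G y z" "x \<in> carrier G"
  shows "conjugate_in G x z"
proof -
  note y = conjugate_in_closed[OF assms(1,3)]
  note z = conjugate_in_closed[OF assms(2) y]
  obtain h k where h: "h \<in> carrier G" "h \<otimes> x = y \<otimes> h" and k: "k \<in> carrier G" "k \<otimes> y = z \<otimes> k"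
    using assms y z by (auto simp: conjugate_in_iff)
  have "(k \<otimes> h) \<otimes> x = z \<otimes> (k \<otimes> h)"
    using h k assms(3) y z by (metis m_assoc)
  then show ?thesis
    using h k assms(3) z by (auto simp: conjugate_in_iff)
qed

lemma strongly_reversible_conj:
  assumes "conjugate_in G x y" "x \<in> carrier G" "strongly_reversible G x"
  shows "strongly_reversible G y"
proof -
  note y = conjugate_in_closed[OF assms(1,2)]
  obtain k where k: "k \<in> carrier G" "y = k \<otimes> x \<otimes> inv k"
    using assms(1) by (auto simp: conjugate_in_def)
  obtain h where h: "h \<in> carrier G" "h \<otimes> h = \<one>" "(h \<otimes> x) \<otimes> (h \<otimes> x) = \<one>"
    using assms(2,3) by (auto simp: strongly_reversible_iff)
  define c where "c a = k \<otimes> a \<otimes> inv k" for a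
  have c: "c a \<otimes> c b = c (a \<otimes> b)" if "a \<in> carrier G" "b \<in> carrier G" for a b
  proof -
    have "c a \<otimes> c b = k \<otimes> a \<otimes> (inv k \<otimes> k) \<otimes> b \<otimes> inv k"
      unfolding c_def using that k(1) by (simp only: m_assoc inv_closed m_closed)
    then show ?thesis
      unfolding c_def using that k(1) by (simp add: m_assoc)
  qed
  have c1: "c \<one> = \<one>"
    using k(1) by (simp add: c_def)
  have "c h \<otimes> c h = \<one>" "(c h \<otimes> y) \<otimes> (c h \<otimes> y) = \<one>"
    unfolding k(2) c_def[of x, symmetric] using h assms(2) by (simp_all add: c c1)
  moreover have "c h \<in> carrier G"
    using h k(1) by (simp add: c_def)
  ultimately show ?thesis
    using y by (auto simp: strongly_reversible_iff)
qed

end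

section \<open>Normal forms under affine conjugation\<close>

interpretation SU: group "special_unitary n" for n
  by (rule group_special_unitary)

interpretation SUA: group "special_unitary_affine n" for n
  by (rule group_special_unitary_affine)

text \<open>The linear part is a group homomorphism. This transfers the assumption on the linear
  part of \<open>g\<close> to its diagonal form.\<close>

lemma conjugate_in_fst:
  assumes "conjugate_in (special_unitary_affine n) g h" "g \<in> carrier (special_unitary_affine n)"
  shows "conjugate_in (special_unitary n) (fst g) (fst h)"
proof -
  note h = SUA.conjugate_in_closed[OF assms]
  obtain A v B w where eq: "g = (A, v)" "h = (B, w)"
    by (metis surj_pair)
  obtain U u where U: "(U, u) \<in> carrier (special_unitary_affine n)"
    "(U, u) \<otimes>\<^bsub>special_unitary_affine n\<^esub> g = h \<otimes>\<^bsub>special_unitary_affine n\<^esub> (U, u)"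
    using assms h SUA.conjugate_in_iff by fastforce
  then show ?thesis
    using assms(2) h unfolding eq
    by (subst SU.conjugate_in_iff)
      (auto simp: in_carrier_affine_iff in_carrier_special_unitary_iff)
qed

text \<open>Conjugating by the translation by \<open>w\<close> changes \<open>v\<close> by an
  element of the image of 1 - \<open>A\<close>. For diagonal \<open>A\<close> this clears every
  coordinate whose eigenvalue is not 1.\<close>

lemma conjugate_in_translation:
  assumes "(A, v) \<in> carrier (special_unitary_affine n)" "w \<in> carrier_vec n"
  shows "conjugate_in (special_unitary_affine n) (A, v) (A, v + w - A *\<^sub>v w)"
proof -
  have c: "A \<in> carrier_mat n n" "v \<in> carrier_vec n"
    using assms by (auto simp: in_carrier_affine_iff unitary_mats_def)
  have "(1\<^sub>m n, w) \<in> carrier (special_unitary_affine n)"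
    using unitary_mat_diag_iff[of n "\<lambda>_. 1"] assms(2) by (simp add: in_carrier_affine_iff)
  moreover have "1\<^sub>m n *\<^sub>v v + w = A *\<^sub>v w + (v + w - A *\<^sub>v w)"
    using c assms(2) by (intro eq_vecI) auto
  ultimately show ?thesis
    using c assms by (subst SUA.conjugate_in_iff) (auto simp: in_carrier_affine_iff intro!: bexI[of _ "(1\<^sub>m n, w)"])
qed

lemma conjugate_in_unitary:
  assumes "(A, v) \<in> carrier (special_unitary_affine n)"
    and U: "U \<in> carrier (special_unitary n)" and D: "D \<in> carrier_mat n n" and AU: "A * U = U * D"
  shows "conjugate_in (special_unitary_affine n) (A, v) (D, mat_adjoint U *\<^sub>v v)"
proof -
  have A: "A \<in> unitary_mats n" "det A = 1" and v: "v \<in> carrier_vec n" and U: "U \<in> unitary_mats n" "det U = 1"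
    using assms by (auto simp: in_carrier_affine_iff in_carrier_special_unitary_iff)
  note Ac = unitaryD[OF A(1)] and Uc = unitaryD[OF U(1)]
  have D_eq: "D = mat_adjoint U * A * U"
    using unitary_cancel(1)[OF U(1) D] Ac Uc AU by (simp add: assoc_mult_mat[of _ n n _ n _ n])
  have DU: "D \<in> unitary_mats n"
    unfolding D_eq by (intro unitary_mult unitary_adjoint U A)
  have detU: "det (mat_adjoint U) = 1"
    using det_mat_adjoint[OF Uc(1)] U by simp
  have "det D = 1"
    unfolding D_eq using Ac Uc detU A U by (simp add: det_mult[of _ n])
  moreover have "mat_adjoint U * A = D * mat_adjoint U"
    unfolding D_eq using Ac Uc by (simp add: assoc_mult_mat[of _ n n _ n _ n])
  moreover have "(mat_adjoint U, 0\<^sub>v n) \<in> carrier (special_unitary_affine n)"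
    using unitary_adjoint[OF U(1)] detU by (simp add: in_carrier_affine_iff)
  moreover have "mat_adjoint U *\<^sub>v v + 0\<^sub>v n = D *\<^sub>v 0\<^sub>v n + mat_adjoint U *\<^sub>v v"
  proof -
    have "mat_adjoint U *\<^sub>v v \<in> carrier_vec n"
      using Uc v by (intro mult_mat_vec_carrier)
    then show ?thesis
      by (simp add: mult_mat_zero_vec[OF D])
  qed
  ultimately show ?thesis
    using DU Uc v assms(1)
    by (subst SUA.conjugate_in_iff) (auto simp: in_carrier_affine_iff intro!: bexI[of _ "(mat_adjoint U, 0\<^sub>v n)"])
qed

text \<open>Multiplying the first column by the conjugate of \<open>det U\<close> makes the
  determinant 1. The scaling is diagonal, commutes with \<open>mat_diag n d\<close> and so preserves
  the diagonalization. The last column changes only by a nonzero scalar, which differs from 1 at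
  most when \<open>n = 1\<close>.\<close>

lemma special_unitary_rescale:
  assumes U: "U \<in> unitary_mats n" and n: "n \<ge> 1" and A: "A \<in> carrier_mat n n"
    and AU: "A * U = U * mat_diag n d"
  obtains V c where "V \<in> carrier (special_unitary n)" "A * V = V * mat_diag n d"
    "c \<noteq> 0" "col V (n - 1) = c \<cdot>\<^sub>v col U (n - 1)"
proof -
  define f where "f i = (if i = 0 then cnj (det U) else 1)" for i :: nat
  define V where "V = U * mat_diag n f"
  note Uc = unitaryD[OF U] and det = norm_det_unitary[OF U]
  have f: "norm (f i) = 1" for i
    using det by (simp add: f_def)
  have "V \<in> unitary_mats n"
    unfolding V_def by (intro unitary_mult U) (simp add: unitary_mat_diag_iff f)
  moreover have "det V = 1"
  proof -
    have "(\<Prod>i<n. f i) = cnj (det U)"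
      using n by (subst prod.remove[of _ 0]) (auto simp: f_def)
    then show ?thesis
      using det Uc by (simp add: V_def det_mult[of _ n] det_mat_diag mult.commute)
  qed
  moreover have "A * V = V * mat_diag n d"
  proof -
    have "A * V = A * U * mat_diag n f"
      unfolding V_def using A Uc by (simp add: assoc_mult_mat[of _ n n _ n _ n])
    also have "\<dots> = U * (mat_diag n d * mat_diag n f)"
      unfolding AU using Uc by (intro assoc_mult_mat[of _ n n _ n _ n]) auto
    also have "mat_diag n d * mat_diag n f = mat_diag n f * mat_diag n d"
      by (simp add: mult.commute)
    also have "U * \<dots> = V * mat_diag n d"
      unfolding V_def using Uc by (intro assoc_mult_mat[of _ n n _ n _ n, symmetric]) auto
    finally show ?thesis .
  qed
  moreover have "f (n - 1) \<noteq> 0"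
    using f[of "n - 1"] by auto
  moreover have "col V (n - 1) = f (n - 1) \<cdot>\<^sub>v col U (n - 1)"
    unfolding V_def mat_diag_mult_right[OF Uc(1)] using Uc n by (intro eq_vecI) auto
  ultimately show ?thesis
    using that by (auto simp: in_carrier_special_unitary_iff)
qed

lemma affine_diagonalize:
  assumes "n \<ge> 1" "(A, v) \<in> carrier (special_unitary_affine n)"
    and "char_poly A = (\<Prod>a\<leftarrow>es. [:- a, 1:])"
  obtains w where "conjugate_in (special_unitary_affine n) (A, v) (mat_diag n (\<lambda>i. es ! i), w)"
    "\<And>i. i < n \<Longrightarrow> es ! i \<noteq> 1 \<Longrightarrow> w $ i = 0"
proof -
  have A: "A \<in> unitary_mats n"
    using assms(2) by (simp add: in_carrier_affine_iff)
  note Ac = unitaryD[OF A]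
  let ?D = "mat_diag n (\<lambda>i. es ! i)"
  obtain U where "U \<in> unitary_mats n" "A * U = U * ?D"
    using unitary_diagonalize[OF A assms(3)] by blast
  from special_unitary_rescale[OF this(1) assms(1) Ac(1) this(2)]
  obtain V where V: "V \<in> carrier (special_unitary n)" "A * V = V * ?D" .
  define u where "u = mat_adjoint V *\<^sub>v v"
  have 1: "conjugate_in (special_unitary_affine n) (A, v) (?D, u)"
    unfolding u_def by (rule conjugate_in_unitary[OF assms(2) V(1) _ V(2)]) simp
  note Du = SUA.conjugate_in_closed[OF this assms(2)]
  then have uc: "u \<in> carrier_vec n"
    by (simp add: in_carrier_affine_iff)
  \<comment> \<open>This solves (\<open>?D\<close> - 1) \<open>x\<close> = \<open>u\<close> in the
    coordinates where the eigenvalue is not 1. Elsewhere division by zero gives 0, so those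
    coordinates of \<open>u\<close> are left alone.\<close>
  define x where "x = vec n (\<lambda>i. u $ i / (es ! i - 1))"
  define w where "w = u + x - ?D *\<^sub>v x"
  have "conjugate_in (special_unitary_affine n) (?D, u) (?D, w)"
    unfolding w_def by (rule conjugate_in_translation[OF Du]) (simp add: x_def)
  with 1 have "conjugate_in (special_unitary_affine n) (A, v) (?D, w)"
    by (rule SUA.conjugate_in_trans[OF _ _ assms(2)])
  moreover have "w $ i = 0" if i: "i < n" "es ! i \<noteq> 1" for i
  proof -
    have "(?D *\<^sub>v x) $ i = (\<Sum>k<n. ?D $$ (i, k) * x $ k)"
      using i by (intro index_mult_mat_vec_sum[of _ n]) (auto simp: x_def)
    also have "\<dots> = (\<Sum>k<n. if k = i then es ! i * x $ i else 0)"
      using i by (intro sum.cong) (auto simp: mat_diag_def)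
    also have "\<dots> = es ! i * x $ i"
      using i by simp
    finally show ?thesis
      using i uc by (simp add: w_def x_def mat_diag_def field_simps)
  qed
  ultimately show ?thesis
    using that by blast
qed

text \<open>A nonzero fixed vector is an eigenvector for 1 and may span the last column of the
  diagonalizing matrix \<open>V\<close>. In the new basis \<open>v\<close> then becomes a multiple
  of the last basis vector.\<close>

lemma affine_diagonalize_last:
  assumes "(A, v) \<in> carrier (special_unitary_affine n)"
    and "char_poly A = (\<Prod>a\<leftarrow>es @ [1]. [:- a, 1:])"
    and "A *\<^sub>v v = v" "v \<noteq> 0\<^sub>v n"
  obtains c where "c \<noteq> 0" "conjugate_in (special_unitary_affine n) (A, v)
    (mat_diag n (\<lambda>i. (es @ [1]) ! i), vec n (\<lambda>i. if i = n - 1 then c else 0))"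
proof -
  have A: "A \<in> unitary_mats n" and v: "v \<in> carrier_vec n"
    using assms(1) by (auto simp: in_carrier_affine_iff)
  have n: "n \<ge> 1"
    using v assms(4) by (cases n) auto
  note Ac = unitaryD[OF A]
  let ?D = "mat_diag n (\<lambda>i. (es @ [1]) ! i)"
  have "A *\<^sub>v v = 1 \<cdot>\<^sub>v v"
    using assms(3) by simp
  \<comment> \<open>The two underscores stand for the trivial premises left over from discharging
    the induction hypothesis of the step.\<close>
  from unitary_diagonalize_last[OF _ _ A assms(2) v assms(4) this]
  obtain U a where U: "U \<in> unitary_mats n" "A * U = U * ?D" "a \<noteq> 0" "col U (n - 1) = a \<cdot>\<^sub>v v"
    by blast
  from special_unitary_rescale[OF U(1) n Ac(1) U(2)]
  obtain V b where V: "V \<in> carrier (special_unitary n)" "A * V = V * ?D" "b \<noteq> 0"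
    "col V (n - 1) = b \<cdot>\<^sub>v col U (n - 1)" .
  have VU: "V \<in> unitary_mats n"
    using V(1) by (simp add: in_carrier_special_unitary_iff)
  note Vc = unitaryD[OF VU]
  define l :: "complex vec" where "l = unit_vec n (n - 1)"
  have l: "l \<in> carrier_vec n"
    by (simp add: l_def)
  have ba: "V *\<^sub>v l = (b * a) \<cdot>\<^sub>v v"
  proof -
    have "V *\<^sub>v l = col V (n - 1)"
      using Vc n by (intro eq_vecI) (auto simp: l_def)
    then show ?thesis
      unfolding V(4) U(4) by (simp add: smult_smult_assoc)
  qed
  have "l = (b * a) \<cdot>\<^sub>v (mat_adjoint V *\<^sub>v v)"
    using unitary_cancel_vec(1)[OF VU l] Vc v unfolding ba by (simp add: mult_mat_vec[of _ n n])
  then have "inverse (b * a) \<cdot>\<^sub>v l = inverse (b * a) \<cdot>\<^sub>v ((b * a) \<cdot>\<^sub>v (mat_adjoint V *\<^sub>v v))"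
    by (rule arg_cong)
  also have "\<dots> = mat_adjoint V *\<^sub>v v"
  proof -
    have "inverse (b * a) * (b * a) = 1"
      using U(3) V(3) by (intro left_inverse) simp
    then show ?thesis
      by (simp only: smult_smult_assoc one_smult_vec)
  qed
  finally have "mat_adjoint V *\<^sub>v v = vec n (\<lambda>i. if i = n - 1 then inverse (b * a) else 0)"
    using n by (auto simp: l_def intro!: eq_vecI dest: sym)
  moreover have "conjugate_in (special_unitary_affine n) (A, v) (?D, mat_adjoint V *\<^sub>v v)"
    by (rule conjugate_in_unitary[OF assms(1) V(1) _ V(2)]) simp
  ultimately show ?thesis
    using that[of "inverse (b * a)"] U(3) V(3) by simp
qed

text \<open>The reversing involution is \<open>B\<close> with zero translation. The product with
  \<open>(A, v)\<close> has the translation part \<open>B v = - v\<close>, and its square has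
  \<open>B A (- v) - v = v - v = 0\<close>.\<close>

lemma strongly_reversible_fixI:
  assumes g: "(A, v) \<in> carrier (special_unitary_affine n)" and fixed: "A *\<^sub>v v = v"
    and B: "B \<in> carrier (special_unitary n)" "B * B = 1\<^sub>m n" "(B * A) * (B * A) = 1\<^sub>m n" "B *\<^sub>v v = - v"
  shows "strongly_reversible (special_unitary_affine n) (A, v)"
proof -
  have c: "A \<in> carrier_mat n n" "v \<in> carrier_vec n" "B \<in> carrier_mat n n"
    using g B(1) by (auto simp: in_carrier_affine_iff in_carrier_special_unitary_iff unitary_mats_def)
  have "B * A *\<^sub>v (B *\<^sub>v v) = v"
  proof -
    have "B * A *\<^sub>v (B *\<^sub>v v) = B *\<^sub>v (A *\<^sub>v (- v))"
      unfolding B(4) using c by simp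
    also have "- v = (- 1) \<cdot>\<^sub>v v"
      using c by (intro eq_vecI) auto
    also have "B *\<^sub>v (A *\<^sub>v ((- 1) \<cdot>\<^sub>v v)) = (- 1) \<cdot>\<^sub>v (B *\<^sub>v v)"
      using c fixed by (simp add: mult_mat_vec[of _ n n])
    also have "\<dots> = v"
      unfolding B(4) using c by (intro eq_vecI) auto
    finally show ?thesis .
  qed
  then have "B * A *\<^sub>v (B *\<^sub>v v) + B *\<^sub>v v = 0\<^sub>v n"
    unfolding B(4) using c by (intro eq_vecI) auto
  then show ?thesis
    using g B c mult_mat_zero_vec[OF c(3)]
    by (subst SUA.strongly_reversible_iff)
      (auto simp: in_carrier_affine_iff in_carrier_special_unitary_iff intro!: bexI[of _ "(B, 0\<^sub>v n)"])
qed

lemma strongly_reversible_linear: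
  assumes "A \<in> carrier (special_unitary n)" "strongly_reversible (special_unitary n) A"
  shows "strongly_reversible (special_unitary_affine n) (A, 0\<^sub>v n)"
proof -
  obtain B where B: "B \<in> carrier (special_unitary n)" "B * B = 1\<^sub>m n" "(B * A) * (B * A) = 1\<^sub>m n"
    using assms by (auto simp: SU.strongly_reversible_iff)
  then show ?thesis
    using assms(1)
    by (intro strongly_reversible_fixI[OF _ _ B])
      (auto simp: in_carrier_affine_iff in_carrier_special_unitary_iff unitary_mats_def)
qed

text \<open>For unitary \<open>A\<close> the inverse is the adjoint, whose spectrum consists of the
  conjugates. A reversing involution \<open>B\<close> gives
  \<open>mat_adjoint A = B * A * B\<close>, which is similar to \<open>A\<close>.\<close>

lemma reversible_spectrum_cnj:
  assumes A: "A \<in> carrier (special_unitary n)" "strongly_reversible (special_unitary n) A"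
    and cp: "char_poly A = (\<Prod>a\<leftarrow>es. [:- a, 1:])"
  shows "mset (map cnj es) = mset es"
proof -
  have AU: "A \<in> unitary_mats n"
    using A by (simp add: in_carrier_special_unitary_iff)
  note Ac = unitaryD[OF AU]
  obtain B where B: "B \<in> unitary_mats n" "B * B = 1\<^sub>m n" "(B * A) * (B * A) = 1\<^sub>m n"
    using A by (auto simp: SU.strongly_reversible_iff in_carrier_special_unitary_iff)
  note Bc = unitaryD[OF B(1)]
  have len: "length es = n"
    using degree_monic_char_poly[OF Ac(1)] degree_linear_factors[of uminus es] unfolding cp by simp
  obtain U where U: "U \<in> unitary_mats n" "A * U = U * mat_diag n (\<lambda>i. es ! i)"
    using unitary_diagonalize[OF AU cp] by blast
  note Uc = unitaryD[OF U(1)]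
  have "mat_adjoint (mat_adjoint U * (A * U)) = mat_diag n (\<lambda>i. cnj (es ! i))"
    unfolding U(2) by (simp add: unitary_cancel[OF U(1), of _ n])
  then have D: "mat_adjoint U * mat_adjoint A * U = mat_diag n (\<lambda>i. cnj (es ! i))"
    using Ac Uc by (simp add: mat_adjoint_mult[of _ n] assoc_mult_mat[of _ n n _ n _ n])
  have "(\<Prod>a\<leftarrow>map cnj es. [:- a, 1:]) = char_poly (mat_diag n (\<lambda>i. cnj (es ! i)))"
  proof -
    have "map cnj es = map (\<lambda>i. cnj (es ! i)) [0..<n]"
      using len by (intro nth_equalityI) auto
    then show ?thesis
      by (simp only: char_poly_mat_diag)
  qed
  also have "\<dots> = char_poly (mat_adjoint A)"
    unfolding D[symmetric] by (rule char_poly_unitary_conj[OF U(1) Ac(2)])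
  also have "mat_adjoint A = B * A * B"
  proof -
    have "B * A * B = (B * A * B) * (A * mat_adjoint A)"
      using Ac Bc by simp
    also have "\<dots> = (B * A) * (B * A) * mat_adjoint A"
      using Ac Bc by (simp add: assoc_mult_mat[of _ n n _ n _ n])
    finally show ?thesis
      unfolding B(3) using Ac by simp
  qed
  also have "char_poly (B * A * B) = char_poly A"
  proof (rule char_poly_similar)
    show "similar_mat (B * A * B) A"
      unfolding similar_mat_def
      by (intro exI, rule similar_mat_witI[of B B n]) (use Ac Bc B(2) in auto)
  qed
  finally have "proots (\<Prod>a\<leftarrow>map cnj es. [:- a, 1:]) = proots (\<Prod>a\<leftarrow>es. [:- a, 1:])"
    using cp by simp
  \<comment> \<open>The multiset of roots recovers the list of linear factors up to order.\<close>
  moreover have "proots (\<Prod>a\<leftarrow>as. [:- a, 1:]) = mset as" for as :: "complex list"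
  proof (induction as)
    case (Cons a as)
    have "(\<Prod>a\<leftarrow>as. [:- a, 1:]) \<noteq> 0"
      by (auto simp: prod_list_zero_iff)
    then have "proots ([:- a, 1:] * (\<Prod>a\<leftarrow>as. [:- a, 1:])) = proots [:- a, 1:] + mset as"
      by (subst proots_mult) (auto simp only: Cons pCons_eq_0_iff one_neq_zero)
    then show ?case
      by (simp only: list.map prod_list.Cons proots_linear_factor minus_minus) simp
  qed simp
  ultimately show ?thesis by metis
qed

text \<open>The eigenvalues are 1 and -1, and \<open>m\<close> counts the latter. The determinant of
  an involution is thus determined by its trace, which in both uses below is easily read off the
  diagonal.\<close>

lemma unitary_involution_det:
  assumes B: "B \<in> unitary_mats n" "B * B = 1\<^sub>m n"
  obtains m where "(\<Sum>i<n. B $$ (i, i)) = of_nat n - 2 * of_nat m" "det B = (- 1) ^ m"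
proof -
  note Bc = unitaryD[OF B(1)]
  obtain ds where "char_poly B = (\<Prod>a\<leftarrow>ds. [:- a, 1:])"
    using char_poly_factorized[OF Bc(1)] by blast
  then obtain U where U: "U \<in> unitary_mats n" "B * U = U * mat_diag n (\<lambda>i. ds ! i)"
    using unitary_diagonalize[OF B(1)] by blast
  define d where "d i = ds ! i" for i
  define D where "D = mat_diag n d"
  have Dc: "D \<in> carrier_mat n n"
    by (simp add: D_def)
  have BU: "B * U = U * D"
    using U(2) by (simp add: D_def d_def[abs_def])
  note Uc = unitaryD[OF U(1)]
  have BD: "B = U * D * mat_adjoint U"
    unfolding BU[symmetric] using Bc Uc by (simp add: assoc_mult_mat[of _ n n _ n _ n])
  have "U * (D * D) = B * U * D"
    unfolding BU by (rule assoc_mult_mat[OF Uc(1) Dc Dc, symmetric])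
  also have "\<dots> = B * (B * U)"
    by (metis BU assoc_mult_mat[OF Bc(1) Uc(1) Dc])
  also have "\<dots> = U"
    using Bc Uc B(2) by (simp add: assoc_mult_mat[of _ n n _ n _ n, symmetric])
  finally have "mat_adjoint U * (U * (D * D)) = mat_adjoint U * U"
    by simp
  then have DD: "mat_diag n (\<lambda>i. d i * d i) = 1\<^sub>m n"
    using Uc by (simp add: D_def unitary_cancel[OF U(1), of _ n])
  have d: "d i = (if d i = - 1 then - 1 else 1)" if "i < n" for i
    using arg_cong[OF DD, of "\<lambda>M. M $$ (i, i)"] that
    by (auto simp: mat_diag_def square_eq_1_iff)
  define m where "m = card {i. i < n \<and> d i = - 1}"
  have S: "{..<n} \<inter> {i. d i = - 1} = {i. i < n \<and> d i = - 1}"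
    by auto
  have "det B = det D * (cnj (det U) * det U)"
    unfolding BD using Uc Dc by (simp add: det_mult[of _ n] det_mat_adjoint[of _ n])
  also have "\<dots> = (\<Prod>i<n. d i)"
    by (simp add: norm_det_unitary[OF U(1)] D_def det_mat_diag)
  also have "\<dots> = (\<Prod>i<n. if d i = - 1 then - 1 else 1)"
    by (rule prod.cong) (use d in auto)
  also have "\<dots> = (- 1) ^ m"
    by (simp add: prod.If_cases S m_def)
  finally have 1: "det B = (- 1) ^ m" .
  \<comment> \<open>Invariance of the trace: after exchanging the sums, each \<open>d k\<close> is
    weighted by the squared norm of column \<open>k\<close> of \<open>U\<close>, which is 1.\<close>
  have "(\<Sum>i<n. B $$ (i, i)) = (\<Sum>i<n. \<Sum>k<n. U $$ (i, k) * d k * cnj (U $$ (i, k)))"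
  proof (rule sum.cong)
    fix i assume "i \<in> {..<n}"
    then have i: "i < n" by simp
    have "B $$ (i, i) = (\<Sum>k<n. (U * D) $$ (i, k) * mat_adjoint U $$ (k, i))"
      unfolding BD using i Uc Dc by (intro index_mult_mat_sum[of _ n n _ n]) auto
    also have "\<dots> = (\<Sum>k<n. U $$ (i, k) * d k * cnj (U $$ (i, k)))"
      using i Uc unfolding D_def mat_diag_mult_right[OF Uc(1)] by (intro sum.cong) auto
    finally show "B $$ (i, i) = \<dots>" .
  qed simp
  also have "\<dots> = (\<Sum>k<n. \<Sum>i<n. U $$ (i, k) * d k * cnj (U $$ (i, k)))"
    by (rule sum.swap)
  also have "\<dots> = (\<Sum>k<n. d k * (mat_adjoint U * U) $$ (k, k))"
  proof (rule sum.cong)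
    fix k assume "k \<in> {..<n}"
    then have k: "k < n" by simp
    have *: "(mat_adjoint U * U) $$ (k, k) = (\<Sum>i<n. mat_adjoint U $$ (k, i) * U $$ (i, k))"
      using k Uc by (intro index_mult_mat_sum[of _ n n _ n]) auto
    show "(\<Sum>i<n. U $$ (i, k) * d k * cnj (U $$ (i, k))) = d k * (mat_adjoint U * U) $$ (k, k)"
      unfolding * sum_distrib_left by (rule sum.cong) (use k Uc(1) in auto)
  qed simp
  also have "\<dots> = (\<Sum>k<n. 1 - 2 * (if d k = - 1 then 1 else 0))"
  proof (rule sum.cong)
    fix k assume "k \<in> {..<n}"
    then show "d k * (mat_adjoint U * U) $$ (k, k) = 1 - 2 * (if d k = - 1 then 1 else 0)"
      using d[of k] unfolding Uc(3) by (cases "d k = - 1") auto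
  qed simp
  also have "\<dots> = of_nat n - 2 * of_nat m"
  proof -
    have "(\<Sum>k<n. if d k = - 1 then 1 else 0 :: complex) = of_nat m"
      by (simp add: sum.If_cases S m_def)
    then show ?thesis
      by (simp only: sum_subtractf sum_distrib_left[symmetric]) simp
  qed
  finally show ?thesis
    using 1 that by blast
qed

subsection \<open>Reversing involutions\<close>

text \<open>For a permutation \<open>s\<close> of the indices, a generalized permutation matrix:
  basis vector \<open>j\<close> goes to \<open>a j\<close> times basis vector
  \<open>s j\<close>.\<close>

definition monomial_mat :: "nat \<Rightarrow> (nat \<Rightarrow> nat) \<Rightarrow> (nat \<Rightarrow> complex) \<Rightarrow> complex mat" where
  "monomial_mat n s a = mat n n (\<lambda>(i, j). if i = s j then a j else 0)"

lemma monomial_mat_carrier [simp]: "monomial_mat n s a \<in> carrier_mat n n"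
  by (simp add: monomial_mat_def)

lemma monomial_mat_mult_diag:
  "monomial_mat n s a * mat_diag n d = monomial_mat n s (\<lambda>j. a j * d j)"
  unfolding mat_diag_mult_right[OF monomial_mat_carrier]
  by (rule eq_matI) (auto simp: monomial_mat_def)

lemma monomial_mat_square:
  assumes "\<And>j. j < n \<Longrightarrow> s j < n" "\<And>j. j < n \<Longrightarrow> s (s j) = j"
  shows "monomial_mat n s a * monomial_mat n s a = mat_diag n (\<lambda>j. a (s j) * a j)"
proof (rule eq_matI, goal_cases)
  case (1 i j)
  then have ij: "i < n" "j < n"
    by (auto simp: mat_diag_def)
  have "(monomial_mat n s a * monomial_mat n s a) $$ (i, j) =
      (\<Sum>l<n. monomial_mat n s a $$ (i, l) * monomial_mat n s a $$ (l, j))"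
    using ij by (intro index_mult_mat_sum[of _ n n _ n]) auto
  also have "\<dots> = (\<Sum>l<n. if l = s j then (if i = j then a (s j) * a j else 0) else 0)"
    using ij assms by (intro sum.cong) (auto simp: monomial_mat_def)
  finally show ?case
    using ij assms by (simp add: mat_diag_def)
qed (auto simp: mat_diag_def monomial_mat_def)

text \<open>Exchanges the positions of the two members in each of the \<open>k\<close> conjugate
  pairs that open the diagonal.\<close>

definition pair_swap :: "nat \<Rightarrow> nat \<Rightarrow> nat" where
  "pair_swap k j = (if j < 2 * k then if even j then j + 1 else j - 1 else j)"

lemma pair_swap_less_iff: "pair_swap k j < 2 * k \<longleftrightarrow> j < 2 * k"
  unfolding pair_swap_def by presburger

lemma pair_swap_less: "2 * k \<le> n \<Longrightarrow> j < n \<Longrightarrow> pair_swap k j < n"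
  unfolding pair_swap_def by presburger

lemma pair_swap_invol [simp]: "pair_swap k (pair_swap k j) = j"
  unfolding pair_swap_def by presburger

lemma pair_swap_fixed_iff: "pair_swap k j = j \<longleftrightarrow> 2 * k \<le> j"
  unfolding pair_swap_def by presburger

lemma pair_swap_ge [simp]: "2 * k \<le> j \<Longrightarrow> pair_swap k j = j"
  by (simp add: pair_swap_def)

text \<open>\<open>B\<close> swaps the coordinates within each pair and acts by signs on the others,
  with -1 in the last place. The assumption on \<open>d\<close> is exactly what makes
  \<open>B * mat_diag n d\<close> an involution. The swaps and the last sign contribute
  \<open>k + 1\<close> eigenvalues -1; for even \<open>k\<close> one more sign is needed, and
  \<open>parity\<close> provides a coordinate for it.\<close>

lemma reversing_involution_exists:
  fixes d :: "nat \<Rightarrow> complex"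
  assumes kn: "2 * k < n" and d: "\<And>j. j < n \<Longrightarrow> d (pair_swap k j) * d j = 1"
    and parity: "odd k \<or> 2 * k + 1 < n"
  obtains B where "B \<in> carrier (special_unitary n)" "B * B = 1\<^sub>m n"
    "(B * mat_diag n d) * (B * mat_diag n d) = 1\<^sub>m n"
    "\<And>c. B *\<^sub>v vec n (\<lambda>i. if i = n - 1 then c else 0) = - vec n (\<lambda>i. if i = n - 1 then c else 0)"
proof -
  let ?s = "pair_swap k"
  \<comment> \<open>The sign at \<open>2 * k\<close> corrects the determinant when \<open>k\<close> is even.\<close>
  define a :: "nat \<Rightarrow> complex" where
    "a j = (if j = n - 1 then - 1 else if j = 2 * k \<and> even k then - 1 else 1)" for j
  define B where "B = monomial_mat n ?s a"
  have Bc: "B \<in> carrier_mat n n"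
    by (simp add: B_def)
  have s: "?s j < n" if "j < n" for j
    using pair_swap_less[of k n j] kn that by simp
  have as: "a (?s j) = a j" for j
    using kn pair_swap_less_iff[of k j] pair_swap_ge[of k j]
    by (cases "j < 2 * k") (auto simp: a_def)
  have aa: "a j * a j = 1" for j
    by (simp add: a_def)
  have BB: "B * B = 1\<^sub>m n"
    unfolding B_def using s by (subst monomial_mat_square) (auto simp: as aa)
  \<comment> \<open>The entries are real, \<open>pair_swap k\<close> is an involution and
    \<open>a\<close> is invariant under it. Being self-adjoint, \<open>B\<close> is unitary as soon
    as it squares to 1.\<close>
  have "mat_adjoint B = B"
  proof (rule eq_matI)
    fix i j assume "i < dim_row B" "j < dim_col B"
    moreover have "cnj (a i) = a i"
      by (simp add: a_def)
    moreover have "j = ?s i \<longleftrightarrow> i = ?s j"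
      by (metis pair_swap_invol)
    ultimately show "mat_adjoint B $$ (i, j) = B $$ (i, j)"
      by (auto simp: B_def monomial_mat_def as)
  qed (auto simp: B_def monomial_mat_def)
  then have BU: "B \<in> unitary_mats n"
    using Bc BB by (simp add: unitary_mats_def)
  obtain m where m: "(\<Sum>i<n. B $$ (i, i)) = of_nat n - 2 * of_nat m" "det B = (- 1) ^ m"
    using unitary_involution_det[OF BU BB] .
  define z where "z = (if even k then 1 else 0 :: nat)"
  have "(\<Sum>i<n. B $$ (i, i)) = (\<Sum>i<n. if 2 * k \<le> i then a i else 0)"
    using pair_swap_fixed_iff[of k] by (intro sum.cong) (auto simp: B_def monomial_mat_def eq_commute)
  also have "\<dots> = (\<Sum>i\<in>{2*k..<n}. a i)"
    by (simp add: sum.If_cases atLeastLessThan_def lessThan_def Int_def conj_commute)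
  \<comment> \<open>For even \<open>k\<close>, \<open>parity\<close> makes \<open>2 * k\<close> and
    \<open>n - 1\<close> distinct, so the two corrections never fall on the same index.\<close>
  also have "\<dots> = (\<Sum>i\<in>{2*k..<n}. 1 - 2 * (if i = n - 1 then 1 else 0) - 2 * (if i = 2 * k then of_nat z else 0))"
    using parity by (intro sum.cong) (auto simp: a_def z_def)
  also have "\<dots> = of_nat (n - 2 * k) - 2 - 2 * of_nat z"
    using kn by (simp add: sum_subtractf sum_distrib_left[symmetric])
  also have "\<dots> = of_nat n - 2 * of_nat (k + 1 + z)"
    using kn by (simp add: of_nat_diff)
  finally have "2 * (of_nat m :: complex) = 2 * of_nat (k + 1 + z)"
    unfolding m(1) by (rule diff_left_imp_eq)
  then have "m = k + 1 + z"
    by (metis mult_left_cancel of_nat_eq_iff zero_neq_numeral)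
  then have "even m"
    by (simp add: z_def)
  then have "B \<in> carrier (special_unitary n)"
    using m(2) BU by (simp add: in_carrier_special_unitary_iff)
  moreover have "(B * mat_diag n d) * (B * mat_diag n d) = 1\<^sub>m n"
  proof -
    have "a (?s j) * d (?s j) * (a j * d j) = 1" if "j < n" for j
    proof -
      have "a (?s j) * d (?s j) * (a j * d j) = (a j * a j) * (d (?s j) * d j)"
        by (simp add: as mult_ac)
      then show ?thesis
        using that d aa by simp
    qed
    then have "mat_diag n (\<lambda>j. a (?s j) * d (?s j) * (a j * d j)) = 1\<^sub>m n"
      by (intro eq_matI) (auto simp: mat_diag_def)
    then show ?thesis
      unfolding B_def monomial_mat_mult_diag using s by (subst monomial_mat_square) auto
  qed
  moreover have "B *\<^sub>v vec n (\<lambda>i. if i = n - 1 then c else 0) = - vec n (\<lambda>i. if i = n - 1 then c else 0)"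
    (is "B *\<^sub>v ?v = _") for c
  proof (rule eq_vecI)
    fix i assume "i < dim_vec (- ?v)"
    then have i: "i < n" by simp
    have "(B *\<^sub>v ?v) $ i = (\<Sum>l<n. B $$ (i, l) * ?v $ l)"
      using i Bc by (intro index_mult_mat_vec_sum[of _ n]) auto
    also have "\<dots> = (\<Sum>l<n. if l = n - 1 then (if i = n - 1 then - c else 0) else 0)"
      using i kn by (intro sum.cong) (auto simp: B_def monomial_mat_def a_def)
    also have "\<dots> = (- ?v) $ i"
      using i kn by simp
    finally show "(B *\<^sub>v ?v) $ i = (- ?v) $ i" .
  qed (use Bc in auto)
  ultimately show ?thesis
    using BB that by blast
qed

section \<open>Splitting the spectrum into conjugate pairs and real eigenvalues\<close>

lemma mset_conjugate_pairs:
  "mset (concat (map (\<lambda>m. [m, cnj m]) ms)) = mset ms + mset (map cnj ms)"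
  by (induction ms) auto

lemma length_conjugate_pairs: "length (concat (map (\<lambda>m. [m, cnj m]) ms)) = 2 * length ms"
  by (induction ms) auto

lemma nth_conjugate_pairs:
  "j < 2 * length ms \<Longrightarrow> concat (map (\<lambda>m. [m, cnj m]) ms) ! j =
    (if even j then ms ! (j div 2) else cnj (ms ! (j div 2)))"
proof (induction ms arbitrary: j)
  case (Cons m ms)
  consider "j = 0" | "j = 1" | i where "j = Suc (Suc i)"
    by (metis One_nat_def not0_implies_Suc)
  then show ?case
    using Cons by cases auto
qed simp

text \<open>Closure under conjugation matches the entries below the real axis with those above it,
  counted with multiplicity; real entries of modulus 1 square to 1. One copy of 1 is set aside at
  the end for the fixed vector.\<close>

lemma conjugation_closed_split:
  assumes closed: "mset (map cnj es) = mset es" and norm: "\<And>e. e \<in> set es \<Longrightarrow> norm e = 1"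
    and one: "1 \<in> set es"
  obtains ms rs where "mset es = mset ((concat (map (\<lambda>m. [m, cnj m]) ms) @ rs) @ [1])"
    "\<And>m. m \<in> set ms \<Longrightarrow> Im m > 0 \<and> norm m = 1" "\<And>e. e \<in> set rs \<Longrightarrow> e * e = 1"
proof -
  define ms where "ms = filter (\<lambda>e. Im e > 0) es"
  define R where "R = filter (\<lambda>e. Im e = 0) es"
  \<comment> \<open>Filtering both sides of \<open>closed\<close> by the sign of the imaginary part,
    which conjugation flips.\<close>
  have neg: "mset (filter (\<lambda>e. Im e < 0) es) = mset (map cnj ms)"
  proof -
    have "mset (filter (\<lambda>e. Im e < 0) es) = filter_mset (\<lambda>e. Im e < 0) (mset (map cnj es))"
      unfolding closed by simp
    also have "\<dots> = mset (filter (\<lambda>e. Im e < 0) (map cnj es))"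
      by (simp only: mset_filter)
    also have "filter (\<lambda>e. Im e < 0) (map cnj es) = map cnj ms"
      by (simp add: filter_map ms_def comp_def)
    finally show ?thesis .
  qed
  have split: "mset xs = mset (filter (\<lambda>e. Im e > 0) xs) + mset (filter (\<lambda>e. Im e < 0) xs) +
      mset (filter (\<lambda>e. Im e = 0) xs)" for xs :: "complex list"
    by (induction xs) auto
  have R1: "1 \<in> set R"
    using one by (simp add: R_def)
  have "mset es = mset ms + mset (map cnj ms) + mset R"
    using split[of es] unfolding neg by (simp only: ms_def R_def)
  also have "mset R = mset (remove1 1 R) + {#1#}"
    using R1 by simp
  finally have "mset es = mset ((concat (map (\<lambda>m. [m, cnj m]) ms) @ remove1 1 R) @ [1])"
    by (simp only: mset_append mset_conjugate_pairs mset.simps add.assoc)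
  moreover have "Im m > 0 \<and> norm m = 1" if "m \<in> set ms" for m
    using that norm by (auto simp: ms_def)
  moreover have "e * e = 1" if "e \<in> set (remove1 1 R)" for e
  proof -
    have e: "Im e = 0" "norm e = 1"
      using that norm notin_set_remove1[of e R 1] by (auto simp: R_def)
    then have "e * cnj e = 1"
      by (simp add: complex_norm_square[symmetric])
    moreover have "cnj e = e"
      using e by (simp add: complex_eq_iff)
    ultimately show ?thesis by simp
  qed
  ultimately show ?thesis
    using that by blast
qed

text \<open>Let \<open>(B, w)\<close> be a reversing involution. Inverting a spectrum that is
  nonreal except for the last 1 forces zeros on the diagonal of \<open>B\<close> except in the last
  place. That last entry must be -1 because \<open>c\<close> is nonzero. The trace is then -1, so -1
  has multiplicity \<open>2 * r + 1\<close> and \<open>det B = - 1\<close>.\<close>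

lemma rotation_not_strongly_reversible:
  assumes g: "(rotation_diag r \<theta>, last_coord_vec r c) \<in> carrier (special_unitary_affine (4 * r + 1))"
    and c: "c \<noteq> 0" and \<theta>: "\<And>k. k \<in> {1..2 * r} \<Longrightarrow> \<theta> k \<in> {0<..<pi}"
  shows "\<not> strongly_reversible (special_unitary_affine (4 * r + 1)) (rotation_diag r \<theta>, last_coord_vec r c)"
proof
  define n where "n = 4 * r + 1"
  define D where "D = rotation_diag r \<theta>"
  define v where "v = last_coord_vec r c"
  assume "strongly_reversible (special_unitary_affine (4 * r + 1)) (rotation_diag r \<theta>, last_coord_vec r c)"
  then obtain B w where h: "(B, w) \<in> carrier (special_unitary_affine n)"
    "B * B = 1\<^sub>m n" "B *\<^sub>v w + w = 0\<^sub>v n" "(B * D) * (B * D) = 1\<^sub>m n"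
    "B * D *\<^sub>v (B *\<^sub>v v + w) + (B *\<^sub>v v + w) = 0\<^sub>v n"
    using g by (auto simp: SUA.strongly_reversible_iff n_def D_def v_def)
  have B: "B \<in> unitary_mats n" "det B = 1" and w: "w \<in> carrier_vec n"
    using h(1) by (auto simp: in_carrier_affine_iff)
  have v: "v \<in> carrier_vec n"
    by (simp add: v_def last_coord_vec_def n_def)
  note Bc = unitaryD(1)[OF B(1)]
  obtain d where D: "D = mat_diag n d" and dl: "d (4 * r) = 1"
    and d: "\<And>j. j < 4 * r \<Longrightarrow> d j = exp (\<i> * of_real (\<theta> (j div 2 + 1))) \<or>
      d j = exp (- \<i> * of_real (\<theta> (j div 2 + 1)))"
    unfolding D_def rotation_diag_def n_def by (auto intro!: that)
  have Dc: "D \<in> carrier_mat n n"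
    by (simp add: D)
  have Imd: "Im (d j) \<noteq> 0" if "j < 4 * r" for j
  proof -
    have "j div 2 + 1 \<in> {1..2 * r}"
      using that by auto
    then have "sin (\<theta> (j div 2 + 1)) > 0"
      using \<theta>[of "j div 2 + 1"] by (intro sin_gt_zero) auto
    then show ?thesis
      using d[OF that] by (auto simp: Im_exp)
  qed
  have DBD: "D * B * D = B"
  proof -
    have "D * B * D = (B * B) * (D * B * D)"
      using h(2) Dc Bc by simp
    also have "\<dots> = B * ((B * D) * (B * D))"
      using Dc Bc by (simp add: assoc_mult_mat[of _ n n _ n _ n] mult_carrier_mat[of _ n n _ n])
    also have "\<dots> = B"
      using Bc by (simp add: h(4))
    finally show ?thesis .
  qed
  \<comment> \<open>An entry of \<open>B\<close> can be nonzero only where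
    \<open>d i * d j = 1\<close>. The next two facts apply this to the diagonal and to the last
    row.\<close>
  have entry: "d i * B $$ (i, j) * d j = B $$ (i, j)" if "i < n" "j < n" for i j
  proof -
    have "B $$ (i, j) = (D * B * D) $$ (i, j)"
      by (simp only: DBD)
    also have "D * B = mat n n (\<lambda>(i, j). d i * B $$ (i, j))"
      unfolding D by (rule mat_diag_mult_left[OF Bc])
    also have "(\<dots> * D) $$ (i, j) = d i * B $$ (i, j) * d j"
      unfolding D using that by (subst mat_diag_mult_right[of _ n]) auto
    finally show ?thesis by simp
  qed
  have diag0: "B $$ (i, i) = 0" if "i < 4 * r" for i
  proof (rule ccontr)
    assume "B $$ (i, i) \<noteq> 0"
    moreover have "(d i * d i) * B $$ (i, i) = 1 * B $$ (i, i)"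
      using entry[of i i] that by (simp add: n_def mult_ac)
    ultimately have "d i * d i = 1"
      by (metis mult_cancel_right)
    then have "d i = 1 \<or> d i = - 1"
      by (simp only: square_eq_1_iff)
    then show False
      using Imd[OF that] by auto
  qed
  have row0: "B $$ (4 * r, j) = 0" if "j < 4 * r" for j
  proof (rule ccontr)
    assume "B $$ (4 * r, j) \<noteq> 0"
    moreover have "B $$ (4 * r, j) * d j = B $$ (4 * r, j) * 1"
      using entry[of "4 * r" j] that unfolding dl n_def by simp
    ultimately have "d j = 1"
      by (metis mult_cancel_left)
    then show False
      using Imd[OF that] by auto
  qed
  \<comment> \<open>As the rest of the last row vanishes, \<open>B\<close> acts on the last
    coordinate as multiplication by \<open>s\<close>, while \<open>D\<close> leaves that coordinate
    unchanged.\<close>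
  define s where "s = B $$ (4 * r, 4 * r)"
  have last: "(B *\<^sub>v x) $ (4 * r) = s * x $ (4 * r)" if "x \<in> carrier_vec n" for x
  proof -
    have "(B *\<^sub>v x) $ (4 * r) = (\<Sum>l<n. B $$ (4 * r, l) * x $ l)"
      using that Bc by (intro index_mult_mat_vec_sum[of _ n]) (auto simp: n_def)
    also have "\<dots> = s * x $ (4 * r)"
      by (simp add: n_def s_def row0)
    finally show ?thesis .
  qed
  have lastD: "(D *\<^sub>v x) $ (4 * r) = x $ (4 * r)" if "x \<in> carrier_vec n" for x
  proof -
    have "(D *\<^sub>v x) $ (4 * r) = (\<Sum>l<n. D $$ (4 * r, l) * x $ l)"
      using that Dc by (intro index_mult_mat_vec_sum[of _ n]) (auto simp: n_def)
    also have "\<dots> = x $ (4 * r)"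
      by (simp add: n_def D mat_diag_def dl)
    finally show ?thesis .
  qed
  have "s * s = 1"
  proof -
    have "1 = (B * B) $$ (4 * r, 4 * r)"
      unfolding h(2) by (simp add: n_def)
    also have "\<dots> = (\<Sum>l<n. B $$ (4 * r, l) * B $$ (l, 4 * r))"
      using Bc by (intro index_mult_mat_sum[of _ n n _ n]) (auto simp: n_def)
    also have "\<dots> = s * s"
      by (simp add: n_def s_def row0)
    finally show ?thesis by simp
  qed
  \<comment> \<open>If \<open>s = 1\<close>, the two involution equations read
    \<open>2 w = 0\<close> and \<open>2 (c + w) = 0\<close> in the last coordinate, which
    contradicts \<open>c\<close> being nonzero.\<close>
  moreover have "s \<noteq> 1"
  proof
    assume s: "s = 1"
    define x where "x = B *\<^sub>v v + w"
    have xc: "x \<in> carrier_vec n"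
      using Bc v w by (simp add: x_def)
    have "w $ (4 * r) + w $ (4 * r) = (B *\<^sub>v w + w) $ (4 * r)"
      using w by (subst index_add_vec) (auto simp: last s n_def)
    then have w0: "w $ (4 * r) = 0"
      unfolding h(3) by (simp add: n_def)
    have "(B * D *\<^sub>v x) $ (4 * r) = (B *\<^sub>v (D *\<^sub>v x)) $ (4 * r)"
      using Bc Dc xc by (subst assoc_mult_mat_vec) auto
    also have "\<dots> = x $ (4 * r)"
      using last[OF mult_mat_vec_carrier[OF Dc xc]] lastD[OF xc] s by simp
    finally have "x $ (4 * r) + x $ (4 * r) = (B * D *\<^sub>v x + x) $ (4 * r)"
      using xc by (subst index_add_vec) (auto simp: n_def)
    then have "x $ (4 * r) = 0"
      using h(5) unfolding x_def[symmetric] by (simp add: n_def)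
    moreover have "x $ (4 * r) = c + w $ (4 * r)"
      unfolding x_def using w v by (subst index_add_vec) (auto simp: last s n_def v_def last_coord_vec_def)
    ultimately show False
      using c w0 by simp
  qed
  ultimately have s: "s = - 1"
    by (auto simp: square_eq_1_iff)
  obtain m where m: "(\<Sum>i<n. B $$ (i, i)) = of_nat n - 2 * of_nat m" "det B = (- 1) ^ m"
    using unitary_involution_det[OF B(1) h(2)] .
  have "(\<Sum>i<n. B $$ (i, i)) = - 1"
    using s by (simp add: n_def diag0 s_def)
  then have "2 * (of_nat m :: complex) = 2 * of_nat (2 * r + 1)"
    using m(1) by (simp add: n_def algebra_simps)
  then have "m = 2 * r + 1"
    by (simp only: mult_cancel_left of_nat_eq_iff) simp
  then show False
    using m(2) B(2) by simp
qed

section \<open>The classification up to conjugacy\<close>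

lemma last_coord_fixed:
  assumes "n \<ge> 1" "d (n - 1) = 1"
  shows "mat_diag n d *\<^sub>v vec n (\<lambda>i. if i = n - 1 then c else 0) = vec n (\<lambda>i. if i = n - 1 then c else (0 :: complex))"
    (is "_ *\<^sub>v ?v = _")
proof (rule eq_vecI)
  fix i assume "i < dim_vec ?v"
  then have i: "i < n" by simp
  have "(mat_diag n d *\<^sub>v ?v) $ i = (\<Sum>l<n. mat_diag n d $$ (i, l) * ?v $ l)"
    using i by (intro index_mult_mat_vec_sum[of _ n]) auto
  also have "\<dots> = (\<Sum>l<n. if l = i then ?v $ i else 0)"
    using i assms by (intro sum.cong) (auto simp: mat_diag_def)
  finally show "(mat_diag n d *\<^sub>v ?v) $ i = ?v $ i"
    using i by simp
qed (simp add: mat_diag_def)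


theorem theorem1p8:
  fixes n :: nat and g :: "complex mat \<times> complex vec"
  assumes "n \<ge> 1"
    and "g \<in> carrier (special_unitary_affine n)"
    and "strongly_reversible (special_unitary n) (fst g)"
  shows "\<not> strongly_reversible (special_unitary_affine n) g \<longleftrightarrow>
    (\<exists>(r :: nat) (\<theta> :: nat \<Rightarrow> real) (v1 :: complex).
        n = 4 * r + 1 \<and> v1 \<noteq> 0 \<and> (\<forall>k\<in>{1..2 * r}. \<theta> k \<in> {0<..<pi}) \<and>
        conjugate_in (special_unitary_affine n) g (rotation_diag r \<theta>, last_coord_vec r v1))"
    (is "?L \<longleftrightarrow> ?R")
proof
  assume ?R
  then obtain r \<theta> c where n: "n = 4 * r + 1" and c: "c \<noteq> 0"
    and \<theta>: "\<And>k. k \<in> {1..2 * r} \<Longrightarrow> \<theta> k \<in> {0<..<pi}"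
    and conj: "conjugate_in (special_unitary_affine n) g (rotation_diag r \<theta>, last_coord_vec r c)"
    by blast
  have "\<not> strongly_reversible (special_unitary_affine n) (rotation_diag r \<theta>, last_coord_vec r c)"
    using rotation_not_strongly_reversible[of r \<theta> c] \<theta> c SUA.conjugate_in_closed[OF conj assms(2)]
    unfolding n by blast
  then show ?L
    using SUA.strongly_reversible_conj[OF conj assms(2)] by blast
next
  assume L: ?L
  let ?G = "special_unitary_affine n"
  have not_sr: "\<not> strongly_reversible ?G h" if "conjugate_in ?G g h" for h
    using L SUA.strongly_reversible_conj[OF SUA.conjugate_in_sym[OF that assms(2)]
        SUA.conjugate_in_closed[OF that assms(2)]] by blast
  obtain A v where g: "g = (A, v)"
    by (metis surj_pair)
  have gc: "(A, v) \<in> carrier ?G"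
    using assms(2) by (simp add: g)
  have A: "A \<in> carrier (special_unitary n)" and AU: "A \<in> unitary_mats n"
    using gc by (auto simp: in_carrier_affine_iff in_carrier_special_unitary_iff)
  have srA: "strongly_reversible (special_unitary n) A"
    using assms(3) by (simp add: g)
  obtain es where es: "char_poly A = (\<Prod>a\<leftarrow>es. [:- a, 1:])" "length es = n"
    using char_poly_factorized[OF unitaryD(1)[OF AU]] by blast
  define D where "D = mat_diag n (\<lambda>i. es ! i)"
  obtain w where w: "conjugate_in ?G g (D, w)" "\<And>i. i < n \<Longrightarrow> es ! i \<noteq> 1 \<Longrightarrow> w $ i = 0"
    using affine_diagonalize[OF assms(1) gc es(1)] unfolding g D_def by blast
  have Dw: "(D, w) \<in> carrier ?G"
    by (rule SUA.conjugate_in_closed[OF w(1) assms(2)])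
  then have D: "D \<in> carrier (special_unitary n)" "D \<in> unitary_mats n" and wc: "w \<in> carrier_vec n"
    by (auto simp: in_carrier_affine_iff in_carrier_special_unitary_iff)
  \<comment> \<open>Otherwise \<open>g\<close> would be conjugate to a linear element, which
    inherits strong reversibility from the linear part of \<open>g\<close>.\<close>
  have w0: "w \<noteq> 0\<^sub>v n"
  proof
    assume "w = 0\<^sub>v n"
    moreover have "conjugate_in (special_unitary n) A D"
      using conjugate_in_fst[OF w(1) assms(2)] by (simp add: g)
    then have "strongly_reversible (special_unitary n) D"
      using SU.strongly_reversible_conj A srA by blast
    ultimately show False
      using strongly_reversible_linear[OF D(1)] not_sr[OF w(1)] by simp
  qed
  then obtain i where "i < n" "w $ i \<noteq> 0"
    using wc by (metis carrier_vecD dim_vec eq_vecI index_zero_vec)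
  \<comment> \<open>A nonzero coordinate of \<open>w\<close> can sit only at an eigenvalue
    1.\<close>
  then have one: "1 \<in> set es"
    using w(2)[of i] es(2) nth_mem[of i es] by metis
  have norm: "norm e = 1" if "e \<in> set es" for e
    using that D(2) es(2) by (auto simp: D_def unitary_mat_diag_iff in_set_conv_nth)
  obtain ms rs where ms_rs: "mset es = mset ((concat (map (\<lambda>m. [m, cnj m]) ms) @ rs) @ [1])"
    and ms: "\<And>m. m \<in> set ms \<Longrightarrow> Im m > 0 \<and> norm m = 1" and rs: "\<And>e. e \<in> set rs \<Longrightarrow> e * e = 1"
    using conjugation_closed_split[OF reversible_spectrum_cnj[OF A srA es(1)] norm one] by blast
  define k where "k = length ms"
  define fs where "fs = concat (map (\<lambda>m. [m, cnj m]) ms) @ rs"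
  have n: "n = 2 * k + length rs + 1"
    using arg_cong[OF ms_rs, of size] es(2) by (simp add: length_conjugate_pairs k_def del: mset_append)
  have len: "length fs = 2 * k + length rs"
    by (simp add: fs_def length_conjugate_pairs k_def)
  \<comment> \<open>The characteristic polynomial sees only the multiset of eigenvalues. A second
    diagonalization can therefore use the order of \<open>fs @ [1]\<close>: conjugate pairs, other
    real eigenvalues, and finally the 1 belonging to \<open>w\<close>.\<close>
  have "char_poly D = (\<Prod>a\<leftarrow>es. [:- a, 1:])"
    unfolding D_def char_poly_mat_diag es(2)[symmetric] map_nth ..
  also have "\<dots> = prod_mset (image_mset (\<lambda>a. [:- a, 1:]) (mset es))"
    by (simp only: mset_map[symmetric] prod_mset_prod_list)
  also have "\<dots> = (\<Prod>a\<leftarrow>fs @ [1]. [:- a, 1:])"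
    unfolding ms_rs fs_def[symmetric] by (simp only: mset_map[symmetric] prod_mset_prod_list)
  finally have cpD: "char_poly D = (\<Prod>a\<leftarrow>fs @ [1]. [:- a, 1:])" .
  have fixed: "D *\<^sub>v w = w"
  proof (rule eq_vecI)
    fix i assume "i < dim_vec w"
    then have i: "i < n" using wc by simp
    have "(D *\<^sub>v w) $ i = (\<Sum>l<n. D $$ (i, l) * w $ l)"
      using i wc by (intro index_mult_mat_vec_sum[of _ n]) (auto simp: D_def)
    also have "\<dots> = (\<Sum>l<n. if l = i then w $ i else 0)"
      using i w(2)[of i] by (intro sum.cong) (auto simp: D_def mat_diag_def)
    finally show "(D *\<^sub>v w) $ i = w $ i"
      using i by simp
  qed (use wc in \<open>simp add: D_def mat_diag_def\<close>)
  define d where "d i = (fs @ [1]) ! i" for i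
  let ?v = "\<lambda>c. vec n (\<lambda>i. if i = n - 1 then c else 0)"
  obtain c where c: "c \<noteq> 0" and "conjugate_in ?G (D, w) (mat_diag n d, ?v c)"
    using affine_diagonalize_last[OF Dw cpD fixed w0] unfolding d_def by blast
  then have conj: "conjugate_in ?G g (mat_diag n d, ?v c)"
    using SUA.conjugate_in_trans[OF w(1) _ assms(2)] by blast
  have d_pair: "d j = (if even j then ms ! (j div 2) else cnj (ms ! (j div 2)))" if "j < 2 * k" for j
    using that by (simp add: d_def fs_def nth_append length_conjugate_pairs nth_conjugate_pairs k_def)
  have d_last: "d (n - 1) = 1"
    by (simp add: d_def nth_append len n)
  have d_real: "d j * d j = 1" if "2 * k \<le> j" "j < n" for j
  proof (cases "j = n - 1")
    case False
    then have "d j = rs ! (j - 2 * k)" "j - 2 * k < length rs"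
      using that n by (auto simp: d_def fs_def nth_append length_conjugate_pairs k_def)
    then show ?thesis
      using rs nth_mem by metis
  qed (use d_last in auto)
  have ms_norm: "m * cnj m = 1" if "m \<in> set ms" for m
    using ms[OF that] by (simp add: complex_norm_square[symmetric])
  \<comment> \<open>Within a pair this is the squared modulus of an eigenvalue; elsewhere the index
    is fixed and the eigenvalue is 1 or -1.\<close>
  have d_swap: "d (pair_swap k j) * d j = 1" if "j < n" for j
  proof (cases "j < 2 * k")
    case True
    then have "j div 2 < length ms"
      by (auto simp: k_def)
    then have "ms ! (j div 2) * cnj (ms ! (j div 2)) = 1"
      by (intro ms_norm nth_mem)
    moreover have "pair_swap k j < 2 * k" "pair_swap k j div 2 = j div 2" "even (pair_swap k j) \<longleftrightarrow> odd j"
      using True by (auto simp: pair_swap_def elim!: evenE oddE)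
    ultimately show ?thesis
      using True by (auto simp: d_pair mult.commute)
  qed (use d_real that in simp)
  \<comment> \<open>Any other shape of the spectrum would admit a reversing involution. What remains
    is an even number of pairs and \<open>rs = []\<close>.\<close>
  have "\<not> (odd k \<or> 2 * k + 1 < n)"
  proof
    assume parity: "odd k \<or> 2 * k + 1 < n"
    have "2 * k < n"
      by (simp add: n)
    then obtain B where "B \<in> carrier (special_unitary n)" "B * B = 1\<^sub>m n"
      "(B * mat_diag n d) * (B * mat_diag n d) = 1\<^sub>m n" "B *\<^sub>v ?v c = - ?v c"
      using reversing_involution_exists[of k n d, OF _ d_swap parity] by metis
    from strongly_reversible_fixI[OF SUA.conjugate_in_closed[OF conj assms(2)]
        last_coord_fixed[where d = d, OF assms(1) d_last] this]
    show False
      using not_sr[OF conj] by blast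
  qed
  then obtain r where r: "k = 2 * r" and "rs = []"
    using n by (auto elim!: evenE)
  then have nr: "n = 4 * r + 1"
    using n by simp
  \<comment> \<open>The angles are numbered from 1 and the list from 0. Each \<open>ms\<close> entry
    lies on the upper unit half circle, so its argument is the \<open>arccos\<close> of its real
    part and falls strictly between 0 and \<open>pi\<close>.\<close>
  define \<theta> where "\<theta> j = arccos (Re (ms ! (j - 1)))" for j
  have polar: "0 < \<theta> (j + 1) \<and> \<theta> (j + 1) < pi \<and> ms ! j = exp (\<i> * of_real (\<theta> (j + 1)))"
    if "j < k" for j
  proof -
    let ?m = "ms ! j"
    have m: "Im ?m > 0" "norm ?m = 1"
      using ms[of ?m] that by (auto simp: k_def)
    then have sq: "(Re ?m)\<^sup>2 + (Im ?m)\<^sup>2 = 1"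
      by (simp add: cmod_def)
    moreover have "(Im ?m)\<^sup>2 > 0"
      using m by simp
    ultimately have "(Re ?m)\<^sup>2 < 1"
      by linarith
    then have "\<bar>Re ?m\<bar> < 1"
      by (simp only: abs_square_less_1)
    then have Re: "- 1 < Re ?m" "Re ?m < 1"
      by auto
    have "sin (\<theta> (j + 1)) = Im ?m"
      using Re m sq by (simp add: \<theta>_def sin_arccos real_sqrt_unique algebra_simps)
    moreover have "cos (\<theta> (j + 1)) = Re ?m"
      using Re by (simp add: \<theta>_def)
    ultimately have "?m = exp (\<i> * of_real (\<theta> (j + 1)))"
      by (simp add: complex_eq_iff Re_exp Im_exp)
    then show ?thesis
      using arccos_lt_bounded[OF Re] by (simp add: \<theta>_def)
  qed
  have "\<theta> j \<in> {0<..<pi}" if "j \<in> {1..2 * r}" for j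
  proof -
    have "j - 1 < k"
      using that by (auto simp: r)
    then show ?thesis
      using polar[of "j - 1"] that by simp
  qed
  moreover have "mat_diag n d = rotation_diag r \<theta>"
  proof -
    have "d j = (if j = 4 * r then 1
          else if even j then exp (\<i> * of_real (\<theta> (j div 2 + 1)))
          else exp (- \<i> * of_real (\<theta> (j div 2 + 1))))" if "j < n" for j
    proof (cases "j = 4 * r")
      case True
      then show ?thesis
        using d_last nr by simp
    next
      case False
      then have j: "j < 2 * k" "j div 2 < k"
        using that nr r by auto
      have "cnj (exp (\<i> * of_real t)) = exp (- \<i> * of_real t)" for t
        by (simp add: complex_eq_iff Re_exp Im_exp)
      then show ?thesis
        using False j polar[OF j(2)] by (simp add: d_pair)
    qed
    then show ?thesis
      unfolding rotation_diag_def nr[symmetric] by (intro eq_matI) (auto simp: mat_diag_def)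
  qed
  moreover have "?v c = last_coord_vec r c"
    by (simp add: last_coord_vec_def nr)
  ultimately show ?R
    using nr c conj by metis
qed

end
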